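(* Let $A$ be a unital algebra with a covering $\{I_i\}_{i\in\mathcal{I}}$ indexed by a finite set $\mathcal{I}$, with quotient maps $\pi_i:A\to A_i=A/I_i$ and $B=\bigoplus_{i\in\mathcal{I}}A_i$. Let $\mathcal{R}$ be a functor from the set $P(\mathcal{I})$ of ordered subsets of $\mathcal{I}$ to the category of unital rings, with structure maps $r^{\zeta}_{\vartheta}:\mathcal{R}(\zeta)\to\mathcal{R}(\vartheta)$ for $\zeta\subset\vartheta$. Let $$S^n=\bigoplus_{\zeta\in P(\mathcal{I}),\ |\zeta|=n}\mathcal{R}(\zeta),$$ and define $d':S^n\to S^{n+1}$ by $$d'x_\zeta=\sum_{\eta\in P(\mathcal{I}),\ \zeta\subset\eta,\ |\eta|=|\zeta|+1}(-1)^{|\eta/\zeta|}\,r^{\zeta}_{\eta}(x_\zeta),\qquad x_\zeta\in\mathcal{R}(\zeta),$$ where $|\eta/\zeta|$ denotes the position (counted from $0$) in $\eta$ at which the difference between $\eta$ and $\zeta$ occurs, i.e. the position of the unique element of $\eta$ not in $\zeta$. Let $\Phi_i:A_i\to\mathcal{R}(\{i\})$, $i\in\mathcal{I}$, be some chosen ring homomorphisms. Let $(C^\bullet,d)$ be the Amitsur complex of the Sweedler coring $B\otimes_A B$ of the covering, with $C^n=B^{\otimes_A(n+1)}$, and let $\phi:C^{n}\to S^{n+1}$, $n\ge 0$, be the additive map defined, for $y_{i_k}\in A_{i_k}$, by $$\phi(y_{i_1}\otimes_A y_{i_2}\otimes_A\cdots\otimes_A y_{i_{n+1}})=r^{\{i_1\}}_\zeta(\Phi_{i_1}(y_{i_1}))\,r^{\{i_2\}}_\zeta(\Phi_{i_2}(y_{i_2}))\cdots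 r^{\{i_{n+1}\}}_\zeta(\Phi_{i_{n+1}}(y_{i_{n+1}}))\in\mathcal{R}(\zeta)$$ if $\zeta=\{i_1,\dots,i_{n+1}\}$, in this order, belongs to $P(\mathcal{I})$, and by $\phi(y_{i_1}\otimes_A\cdots\otimes_A y_{i_{n+1}})=0$ if it does not, i.e. if at least two of the indices are identical. Then: (1) $(S^n,d')_n$ is a cochain complex with coboundary map $d'$, i.e. $d'\circ d'=0$. (2) $\phi$ is a morphism of cochain complexes, i.e. $\phi\circ d=d'\circ\phi$.
   Context: A covering of a unital algebra $A$ is a finite family of two-sided ideals $\{I_i\}_{i\in\mathcal{I}}$ with $\bigcap_{i}I_i=\{0\}$. The map $\pi=\bigoplus_i\pi_i:A\to B=\bigoplus_i A_i$ is then a ring extension and makes $B$ an $A$-bimodule; the unit of $B$ is $1_B=\sum_i\pi_i(1_A)$. Each $A_i$ is regarded as a direct summand of $B$. $P(\mathcal{I})$ is the set of ordered subsets of the finite set $\mathcal{I}$: its elements are the finite sequences (including the empty one) of pairwise distinct elements of $\mathcal{I}$. For $\zeta,\vartheta\in P(\mathcal{I})$ one writes $\zeta\subset\vartheta$ if $\zeta$ is a subset of $\vartheta$ and the order in $\zeta$ is inherited from the order in $\vartheta$. $|\zeta|$ denotes cardinality. A functor $\mathcal{R}$ from $P(\mathcal{I})$ to the category of unital rings assigns to each $\zeta\in P(\mathcal{I})$ a unital ring $\mathcal{R}(\zeta)$ and to each pair $\zeta\subset\vartheta$ a ring homomorphism $r^\zeta_\vartheta:\mathcal{R}(\zeta)\to\mathcal{R}(\vartheta)$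 of unital rings such that $r^\zeta_\zeta=\mathrm{id}$ and $r^{\eta}_{\vartheta}\circ r^{\zeta}_{\eta}=r^{\zeta}_{\vartheta}$ whenever $\zeta\subset\eta\subset\vartheta$. The Amitsur complex of the Sweedler coring $B\otimes_A B$ is $C^n=B^{\otimes_A(n+1)}$, $n\ge0$, with differential $d:C^n\to C^{n+1}$ given by alternately inserting the unit $1=1_B$: $$d(x_0\otimes_A\cdots\otimes_A x_n)=1\otimes_A x_0\otimes_A\cdots\otimes_A x_n+\sum_{i=0}^{n-1}(-1)^{i+1}x_0\otimes_A\cdots\otimes_A x_i\otimes_A 1\otimes_A x_{i+1}\otimes_A\cdots\otimes_A x_n+(-1)^{n+1}x_0\otimes_A\cdots\otimes_A x_n\otimes_A 1.$$ In particular $d(x)=1\otimes_A x-x\otimes_A 1$ for $x\in C^0=B$.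
   Formalization: The additive map φ is assumed to exist with the stated values on pure tensors; for arbitrary chosen homomorphisms Φ_i the formula need not respect tensoring over A (e.g. I_1=I_2=0, Φ_1=id, Φ_2 a nontrivial automorphism), so φ may otherwise be undefined. *)

theory Defs
  imports "HOL-Algebra.Algebra" "HOL-Library.Sublist"
begin

section \<open>Unital algebras, coverings, and the ring extension into the direct sum\<close>

text \<open>The locale \<^locale>\<open>algebra\<close> of the library only covers commutative algebras.\<close>

definition unital_algebra :: "('k, 'c) ring_scheme \<Rightarrow> ('k, 'a, 'b) module_scheme \<Rightarrow> bool" where
  "unital_algebra K A \<longleftrightarrow> module K A \<and> ring A \<and>
     (\<forall>c \<in> carrier K. \<forall>x \<in> carrier A. \<forall>y \<in> carrier A.
        (c \<odot>\<^bsub>A\<^esub> x) \<otimes>\<^bsub>A\<^esub> y = c \<odot>\<^bsub>A\<^esub> (x \<otimes>\<^bsub>A\<^esub> y) \<and>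
        x \<otimes>\<^bsub>A\<^esub> (c \<odot>\<^bsub>A\<^esub> y) = c \<odot>\<^bsub>A\<^esub> (x \<otimes>\<^bsub>A\<^esub> y))"

text \<open>Intersecting with the carrier only matters for the empty family, which covers \<open>A\<close> iff
  \<open>A\<close> is the zero ring.\<close>

definition covering :: "('a, 'b) ring_scheme \<Rightarrow> 'i set \<Rightarrow> ('i \<Rightarrow> 'a set) \<Rightarrow> bool" where
  "covering A I J \<longleftrightarrow> finite I \<and> (\<forall>i \<in> I. ideal (J i) A) \<and>
     carrier A \<inter> (\<Inter>i \<in> I. J i) = {\<zero>\<^bsub>A\<^esub>}"

definition direct_sum_ring :: "'i set \<Rightarrow> ('i \<Rightarrow> ('a, 'b) ring_scheme) \<Rightarrow> ('i \<Rightarrow> 'a) ring" where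
  "direct_sum_ring I R =
     \<lparr>carrier = (\<Pi>\<^sub>E i\<in>I. carrier (R i)),
      monoid.mult = (\<lambda>x y. \<lambda>i\<in>I. x i \<otimes>\<^bsub>R i\<^esub> y i),
      one = (\<lambda>i\<in>I. \<one>\<^bsub>R i\<^esub>),
      ring.zero = (\<lambda>i\<in>I. \<zero>\<^bsub>R i\<^esub>),
      ring.add = (\<lambda>x y. \<lambda>i\<in>I. x i \<oplus>\<^bsub>R i\<^esub> y i)\<rparr>"

text \<open>The inclusion of the \<open>i\<close>-th summand into the direct sum of the rings \<open>R j\<close>, \<open>j \<in> I\<close>.\<close>

definition summand :: "'i set \<Rightarrow> ('i \<Rightarrow> ('a, 'b) ring_scheme) \<Rightarrow> 'i \<Rightarrow> 'a \<Rightarrow> 'i \<Rightarrow> 'a" where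
  "summand I R i y = (\<lambda>j\<in>I. if j = i then y else \<zero>\<^bsub>R j\<^esub>)"

definition covering_ring ::
  "('a, 'b) ring_scheme \<Rightarrow> 'i set \<Rightarrow> ('i \<Rightarrow> 'a set) \<Rightarrow> ('i \<Rightarrow> 'a set) ring" where
  "covering_ring A I J = direct_sum_ring I (\<lambda>i. A Quot J i)"

definition covering_map ::
  "('a, 'b) ring_scheme \<Rightarrow> 'i set \<Rightarrow> ('i \<Rightarrow> 'a set) \<Rightarrow> 'a \<Rightarrow> 'i \<Rightarrow> 'a set" where
  "covering_map A I J a = (\<lambda>i\<in>I. J i +>\<^bsub>A\<^esub> a)"


section \<open>Cochain complexes\<close>

text \<open>Abelian groups are written multiplicatively in the library, so \<open>\<one>\<close> is the zero element.\<close>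

definition cochain_complex ::
  "(nat \<Rightarrow> ('a, 'b) monoid_scheme) \<Rightarrow> (nat \<Rightarrow> 'a \<Rightarrow> 'a) \<Rightarrow> bool" where
  "cochain_complex G d \<longleftrightarrow>
     (\<forall>n. comm_group (G n) \<and> d n \<in> hom (G n) (G (Suc n)) \<and>
        (\<forall>x \<in> carrier (G n). d (Suc n) (d n x) = \<one>\<^bsub>G (Suc (Suc n))\<^esub>))"

definition cochain_map ::
  "(nat \<Rightarrow> ('a, 'b) monoid_scheme) \<Rightarrow> (nat \<Rightarrow> 'a \<Rightarrow> 'a) \<Rightarrow>
   (nat \<Rightarrow> ('c, 'd) monoid_scheme) \<Rightarrow> (nat \<Rightarrow> 'c \<Rightarrow> 'c) \<Rightarrow> (nat \<Rightarrow> 'a \<Rightarrow> 'c) \<Rightarrow> bool" where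
  "cochain_map G d H e f \<longleftrightarrow> cochain_complex G d \<and> cochain_complex H e \<and>
     (\<forall>n. f n \<in> hom (G n) (H n) \<and> (\<forall>x \<in> carrier (G n). f (Suc n) (d n x) = e n (f n x)))"


section \<open>Tensor powers of a ring extension and the Amitsur complex\<close>

text \<open>For a ring homomorphism \<open>f : A \<rightarrow> B\<close>, the ring \<open>B\<close> is an \<open>A\<close>-bimodule via
  \<open>a b = f(a) b\<close> and \<open>b a = b f(a)\<close>. Its \<open>n\<close>-fold tensor power over \<open>A\<close>, for \<open>n \<ge> 1\<close>, is the
  quotient of the free Abelian group on the lists of length \<open>n\<close> over \<open>B\<close> by the subgroup generated
  by additivity in each entry and by the balancing relations between neighbouring entries.
  (For \<open>n = 0\<close> this gives the integers rather than \<open>A\<close>; that case is never used.)\<close>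

definition tensor_gens :: "('b, 'd) ring_scheme \<Rightarrow> nat \<Rightarrow> 'b list set" where
  "tensor_gens B n = {xs. length xs = n \<and> set xs \<subseteq> carrier B}"

definition tensor_rels ::
  "('a, 'c) ring_scheme \<Rightarrow> ('b, 'd) ring_scheme \<Rightarrow> ('a \<Rightarrow> 'b) \<Rightarrow> nat \<Rightarrow> ('b list \<Rightarrow>\<^sub>0 int) set" where
  "tensor_rels A B f n =
     {frag_of (us @ [b \<oplus>\<^bsub>B\<^esub> c] @ vs) - frag_of (us @ [b] @ vs) - frag_of (us @ [c] @ vs) | us vs b c.
        us @ [b] @ vs \<in> tensor_gens B n \<and> c \<in> carrier B} \<union>
     {frag_of (us @ [b \<otimes>\<^bsub>B\<^esub> f a, c] @ vs) - frag_of (us @ [b, f a \<otimes>\<^bsub>B\<^esub> c] @ vs) | us vs a b c.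
        us @ [b, c] @ vs \<in> tensor_gens B n \<and> a \<in> carrier A}"

definition tensor_null ::
  "('a, 'c) ring_scheme \<Rightarrow> ('b, 'd) ring_scheme \<Rightarrow> ('a \<Rightarrow> 'b) \<Rightarrow> nat \<Rightarrow> ('b list \<Rightarrow>\<^sub>0 int) set" where
  "tensor_null A B f n = generate (free_Abelian_group (tensor_gens B n)) (tensor_rels A B f n)"

definition tensor_power ::
  "('a, 'c) ring_scheme \<Rightarrow> ('b, 'd) ring_scheme \<Rightarrow> ('a \<Rightarrow> 'b) \<Rightarrow> nat \<Rightarrow>
   ('b list \<Rightarrow>\<^sub>0 int) set monoid" where
  "tensor_power A B f n = free_Abelian_group (tensor_gens B n) Mod tensor_null A B f n"

definition tensor_class ::
  "('a, 'c) ring_scheme \<Rightarrow> ('b, 'd) ring_scheme \<Rightarrow> ('a \<Rightarrow> 'b) \<Rightarrow> nat \<Rightarrow>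
   ('b list \<Rightarrow>\<^sub>0 int) \<Rightarrow> ('b list \<Rightarrow>\<^sub>0 int) set" where
  "tensor_class A B f n c = tensor_null A B f n #>\<^bsub>free_Abelian_group (tensor_gens B n)\<^esub> c"

text \<open>The pure tensor \<open>x\<^sub>0 \<otimes>\<^sub>A \<cdots> \<otimes>\<^sub>A x\<^sub>n\<close> of the list \<open>[x\<^sub>0, \<dots>, x\<^sub>n]\<close>.\<close>

definition pure_tensor ::
  "('a, 'c) ring_scheme \<Rightarrow> ('b, 'd) ring_scheme \<Rightarrow> ('a \<Rightarrow> 'b) \<Rightarrow> 'b list \<Rightarrow> ('b list \<Rightarrow>\<^sub>0 int) set" where
  "pure_tensor A B f xs = tensor_class A B f (length xs) (frag_of xs)"

definition amitsur_group ::
  "('a, 'c) ring_scheme \<Rightarrow> ('b, 'd) ring_scheme \<Rightarrow> ('a \<Rightarrow> 'b) \<Rightarrow> nat \<Rightarrow>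
   ('b list \<Rightarrow>\<^sub>0 int) set monoid" where
  "amitsur_group A B f n = tensor_power A B f (Suc n)"

text \<open>Inserting the unit before position \<open>k\<close>, that is, after \<open>x\<^bsub>k-1\<^esub>\<close>, carries the sign
  \<open>(-1)\<^sup>k\<close>.\<close>

definition insert_unit :: "('b, 'd) ring_scheme \<Rightarrow> nat \<Rightarrow> 'b list \<Rightarrow> 'b list" where
  "insert_unit B k xs = take k xs @ [\<one>\<^bsub>B\<^esub>] @ drop k xs"

definition amitsur_pre :: "('b, 'd) ring_scheme \<Rightarrow> 'b list \<Rightarrow> ('b list \<Rightarrow>\<^sub>0 int)" where
  "amitsur_pre B xs = (\<Sum>k \<le> length xs. frag_cmul ((- 1) ^ k) (frag_of (insert_unit B k xs)))"

text \<open>The differential is the map induced on cosets by the additive extension of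
  \<^const>\<open>amitsur_pre\<close>.\<close>

definition amitsur_diff ::
  "('a, 'c) ring_scheme \<Rightarrow> ('b, 'd) ring_scheme \<Rightarrow> ('a \<Rightarrow> 'b) \<Rightarrow> nat \<Rightarrow>
   ('b list \<Rightarrow>\<^sub>0 int) set \<Rightarrow> ('b list \<Rightarrow>\<^sub>0 int) set" where
  "amitsur_diff A B f n T =
     the_elem ((\<lambda>c. tensor_class A B f (Suc (Suc n)) (frag_extend (amitsur_pre B) c)) ` T)"


section \<open>Functors on ordered subsets and their cochain complex\<close>

text \<open>Ordered subsets are lists without repetition; the relation \<open>\<zeta> \<subset> \<theta>\<close> is \<^const>\<open>subseq\<close>.\<close>

definition ordered_subsets :: "'i set \<Rightarrow> 'i list set" where
  "ordered_subsets I = {\<zeta>. distinct \<zeta> \<and> set \<zeta> \<subseteq> I}"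

definition ordered_subset_functor ::
  "'i set \<Rightarrow> ('i list \<Rightarrow> ('r, 'm) ring_scheme) \<Rightarrow> ('i list \<Rightarrow> 'i list \<Rightarrow> 'r \<Rightarrow> 'r) \<Rightarrow> bool" where
  "ordered_subset_functor I R r \<longleftrightarrow>
     (\<forall>\<zeta> \<in> ordered_subsets I. ring (R \<zeta>)) \<and>
     (\<forall>\<zeta> \<in> ordered_subsets I. \<forall>\<theta> \<in> ordered_subsets I.
        subseq \<zeta> \<theta> \<longrightarrow> r \<zeta> \<theta> \<in> ring_hom (R \<zeta>) (R \<theta>)) \<and>
     (\<forall>\<zeta> \<in> ordered_subsets I. \<forall>x \<in> carrier (R \<zeta>). r \<zeta> \<zeta> x = x) \<and>
     (\<forall>\<zeta> \<in> ordered_subsets I. \<forall>\<eta> \<in> ordered_subsets I. \<forall>\<theta> \<in> ordered_subsets I.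
        subseq \<zeta> \<eta> \<longrightarrow> subseq \<eta> \<theta> \<longrightarrow> (\<forall>x \<in> carrier (R \<zeta>). r \<eta> \<theta> (r \<zeta> \<eta> x) = r \<zeta> \<theta> x))"

definition level :: "'i set \<Rightarrow> nat \<Rightarrow> 'i list set" where
  "level I n = {\<zeta> \<in> ordered_subsets I. length \<zeta> = n}"

definition functor_group ::
  "'i set \<Rightarrow> ('i list \<Rightarrow> ('r, 'm) ring_scheme) \<Rightarrow> nat \<Rightarrow> ('i list \<Rightarrow> 'r) monoid" where
  "functor_group I R n = sum_group (level I n) (\<lambda>\<zeta>. add_monoid (R \<zeta>))"

text \<open>The position \<open>|\<eta>/\<zeta>|\<close>, counted from \<open>0\<close>, of the unique element of \<open>\<eta>\<close> not in \<open>\<zeta>\<close>.\<close>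

definition gap :: "'i list \<Rightarrow> 'i list \<Rightarrow> nat" where
  "gap \<eta> \<zeta> = (THE k. k < length \<eta> \<and> \<eta> ! k \<notin> set \<zeta>)"

text \<open>The \<open>\<eta>\<close>-component of \<open>d' x\<close> collects the contributions of all summands \<open>x\<^sub>\<zeta>\<close> with
  \<open>\<zeta> \<subset> \<eta>\<close> and \<open>|\<eta>| = |\<zeta>| + 1\<close>.\<close>

definition functor_diff ::
  "'i set \<Rightarrow> ('i list \<Rightarrow> ('r, 'm) ring_scheme) \<Rightarrow> ('i list \<Rightarrow> 'i list \<Rightarrow> 'r \<Rightarrow> 'r) \<Rightarrow> nat \<Rightarrow>
   ('i list \<Rightarrow> 'r) \<Rightarrow> 'i list \<Rightarrow> 'r" where
  "functor_diff I R r n x = (\<lambda>\<eta> \<in> level I (Suc n).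
     finsum (R \<eta>) (\<lambda>\<zeta>. [((- 1) ^ gap \<eta> \<zeta> :: int)] \<cdot>\<^bsub>R \<eta>\<^esub> r \<zeta> \<eta> (x \<zeta>))
       {\<zeta> \<in> level I n. subseq \<zeta> \<eta>})"

text \<open>The ordered product in \<open>R \<zeta>\<close> of the elements \<open>r (\<Phi> i\<^sub>k (y\<^sub>k))\<close>, for \<open>\<zeta> = [i\<^sub>1, \<dots>]\<close> and
  \<open>ys = [y\<^sub>1, \<dots>]\<close>.\<close>

definition phi_value ::
  "('i list \<Rightarrow> ('r, 'm) ring_scheme) \<Rightarrow> ('i list \<Rightarrow> 'i list \<Rightarrow> 'r \<Rightarrow> 'r) \<Rightarrow> ('i \<Rightarrow> 'a \<Rightarrow> 'r) \<Rightarrow>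
   'i list \<Rightarrow> 'a list \<Rightarrow> 'r" where
  "phi_value R r \<Phi> \<zeta> ys =
     foldr (\<otimes>\<^bsub>R \<zeta>\<^esub>) (map2 (\<lambda>i y. r [i] \<zeta> (\<Phi> i y)) \<zeta> ys) \<one>\<^bsub>R \<zeta>\<^esub>"

end

theory Submission
  imports Defs
begin

text \<open>Deleting the \<open>k\<close>-th entry of an ordered subset satisfies the face identities, so \<open>d'\<close> is an
  alternating sum of cofaces and \<open>d' d' = 0\<close>; dually, inserting the unit makes the Amitsur complex a
  complex. Since \<open>\<phi>\<close> is additive, it suffices to compare \<open>\<phi> d\<close> and \<open>d' \<phi>\<close> on tensors of elements
  \<open>y\<^sub>k\<close> of the summands \<open>A\<^bsub>i\<^esub>\<close> of \<open>B\<close>. There they agree coface by coface: splitting the inserted unit as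
  the sum of the units of the summands, the \<open>\<eta>\<close>-component receives only the term whose index tuple is
  \<open>\<eta>\<close>, and inserting that unit does not change the product because \<open>\<Phi>\<close> is unital.\<close>

section \<open>Faces and degeneracies of lists\<close>

text \<open>Sums in the rings \<open>R \<zeta>\<close> are taken over carrier sets, and the terms of
  an iterated coboundary pass through several of these rings. Cancellation is therefore carried out
  once, for formal integer combinations in the type of finitely supported functions, which is an
  abelian group type; homomorphisms out of free abelian groups then transport it. Since the tensor
  powers are quotients of such groups, one cancellation lemma serves both complexes. Two further
  points need work. The Amitsur differential is given by representatives, so it must be shown to
  respect the tensor relations; the critical place is a unit inserted between two balanced entries.
  And the sum in \<open>d'\<close> runs over ordered subsets, with a sign read off by a definite
  description; it has to be reindexed by deleted positions before it can be compared with
  insertions.\<close>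

definition delete_nth :: "nat \<Rightarrow> 'a list \<Rightarrow> 'a list" where
  "delete_nth k xs = take k xs @ drop (Suc k) xs"

text \<open>Generalises \<open>insert_unit\<close> to an arbitrary entry: index lists receive
  insertions too, and in a tensor the inserted entry has to be a variable so that additivity can
  split it.\<close>

definition insert_nth :: "nat \<Rightarrow> 'a \<Rightarrow> 'a list \<Rightarrow> 'a list" where
  "insert_nth k x xs = take k xs @ x # drop k xs"

lemma insert_unit_eq: "insert_unit B k = insert_nth k \<one>\<^bsub>B\<^esub>"
  by (auto simp: insert_unit_def insert_nth_def)

lemma length_delete_nth [simp]: "k < length xs \<Longrightarrow> length (delete_nth k xs) = length xs - 1"
  by (simp add: delete_nth_def)

lemma length_insert_nth [simp]: "length (insert_nth k x xs) = Suc (length xs)"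
  by (simp add: insert_nth_def)

lemma set_insert_nth [simp]: "set (insert_nth k x xs) = insert x (set xs)"
proof -
  have "set xs = set (take k xs) \<union> set (drop k xs)"
    by (metis append_take_drop_id set_append)
  then show ?thesis
    by (simp add: insert_nth_def)
qed

lemma nth_delete_nth:
  "\<lbrakk>k < length xs; i < length xs - 1\<rbrakk> \<Longrightarrow> delete_nth k xs ! i = (if i < k then xs ! i else xs ! Suc i)"
  by (auto simp: delete_nth_def nth_append)

lemma nth_insert_nth:
  "\<lbrakk>k \<le> length xs; i \<le> length xs\<rbrakk> \<Longrightarrow>
    insert_nth k x xs ! i = (if i < k then xs ! i else if i = k then x else xs ! (i - 1))"
proof (cases "k < i")
  case True
  then obtain d where "i = Suc (k + d)"
    using less_imp_Suc_add by blast
  moreover assume "k \<le> length xs" "i \<le> length xs"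
  ultimately show ?thesis
    by (simp add: insert_nth_def nth_append min_def)
qed (auto simp: insert_nth_def nth_append)

lemma insert_nth_insert_nth:
  assumes "j \<le> k" "k \<le> length xs"
  shows "insert_nth j x (insert_nth k x xs) = insert_nth (Suc k) x (insert_nth j x xs)"
  using assms by (intro nth_equalityI) (auto simp: nth_insert_nth)

lemma delete_nth_delete_nth:
  assumes "j \<le> k" "Suc k < length xs"
  shows "delete_nth k (delete_nth j xs) = delete_nth j (delete_nth (Suc k) xs)"
  using assms by (intro nth_equalityI) (auto simp: nth_delete_nth)

text \<open>Insertion and deletion at one position undo each other. In this form the lemma
  determines which index, inserted into \<open>\<zeta>\<close> at \<open>k\<close>, produces a given
  \<open>\<eta>\<close>.\<close>

lemma insert_nth_eq_iff:
  assumes "k < length ys"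
  shows "insert_nth k x xs = ys \<and> k \<le> length xs \<longleftrightarrow> x = ys ! k \<and> delete_nth k ys = xs"
proof -
  have "ys = take k ys @ ys ! k # drop (Suc k) ys"
    using assms by (rule id_take_nth_drop)
  with assms show ?thesis
    by (auto simp: insert_nth_def delete_nth_def min_def nth_append)
qed

lemma insert_nth_append_left:
  "k \<le> length us \<Longrightarrow> insert_nth k x (us @ vs) = insert_nth k x us @ vs"
  by (simp add: insert_nth_def)

lemma insert_nth_append_right:
  "length us \<le> k \<Longrightarrow> insert_nth k x (us @ vs) = us @ insert_nth (k - length us) x vs"
  by (simp add: insert_nth_def)

lemma map2_insert_nth:
  "length xs = length ys \<Longrightarrow>
    map2 f (insert_nth k x xs) (insert_nth k y ys) = insert_nth k (f x y) (map2 f xs ys)"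
  by (simp add: insert_nth_def take_map drop_map take_zip drop_zip)

lemma subseq_delete_nth: "subseq (delete_nth k xs) xs"
proof -
  have "subseq (drop (Suc k) xs) (drop k xs)"
    by (metis add.commute drop_drop plus_1_eq_Suc suffix_drop suffix_imp_subseq)
  then have "subseq (take k xs @ drop (Suc k) xs) (take k xs @ drop k xs)"
    by (rule list_emb_append_mono[OF subseq_order.refl])
  then show ?thesis
    by (simp only: delete_nth_def append_take_drop_id)
qed

text \<open>Converse of \<open>subseq_delete_nth\<close>. If the head of \<open>ys\<close> is
  skipped, the lengths force the rest to coincide, so position 0 was deleted; if the heads match,
  the position found in the tails moves up by one.\<close>

lemma subseq_imp_delete_nth:
  assumes "subseq xs ys" "length ys = Suc (length xs)"
  shows "\<exists>k < length ys. xs = delete_nth k ys"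
  using assms
proof (induction rule: list_emb.induct)
  case (list_emb_Cons xs ys y)
  then have "xs = ys"
    by (simp add: subseq_same_length)
  then have "xs = delete_nth 0 (y # ys)"
    by (simp add: delete_nth_def)
  then show ?case
    by blast
next
  case (list_emb_Cons2 x y xs ys)
  then obtain k where "k < length ys" "xs = delete_nth k ys"
    by auto
  with list_emb_Cons2 have "x # xs = delete_nth (Suc k) (y # ys)"
    by (simp add: delete_nth_def)
  with \<open>k < length ys\<close> show ?case
    by auto
qed (auto simp: delete_nth_def length_Suc_conv)

text \<open>Distinctness gives the definite description in \<open>gap\<close> a unique solution: the
  deleted entry occurs nowhere else, so its position is the only one whose entry is missing.\<close>

lemma gap_delete_nth:
  assumes "distinct xs" "k < length xs"
  shows "gap xs (delete_nth k xs) = k"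
proof -
  define us x vs where "us = take k xs" and "x = xs ! k" and "vs = drop (Suc k) xs"
  have xs: "xs = us @ x # vs"
    using assms(2) unfolding us_def x_def vs_def by (rule id_take_nth_drop)
  have "distinct (us @ x # vs)"
    using assms(1) xs by simp
  then have "set (us @ vs) = set (us @ x # vs) - {x}"
    by auto
  then have set: "set (delete_nth k xs) = set xs - {xs ! k}"
    by (metis delete_nth_def us_def vs_def x_def xs)
  show ?thesis
    unfolding gap_def set using assms by (intro the_equality) (auto simp: nth_eq_iff_index_eq)
qed

text \<open>Ensures that reindexing the sum over \<open>\<zeta>\<close> by deleted positions counts
  each face once.\<close>

lemma inj_on_delete_nth:
  assumes "distinct xs"
  shows "inj_on (\<lambda>k. delete_nth k xs) {..<length xs}"
  using assms by (intro inj_on_inverseI[where g = "gap xs"]) (simp add: gap_delete_nth)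


section \<open>Alternating sums\<close>

text \<open>The terms with \<open>j \<le> k\<close> are matched with the others by sending
  \<open>(j, k)\<close> to \<open>(Suc k, j)\<close>. Induction avoids handling this bijection:
  enlarging \<open>n\<close> adds one column and one row, and these cancel entry by entry.\<close>

lemma sum_sum_cancel:
  fixes h :: "nat \<Rightarrow> nat \<Rightarrow> 'a::ab_group_add"
  assumes "\<And>j k. \<lbrakk>j \<le> k; k \<le> n\<rbrakk> \<Longrightarrow> h j k + h (Suc k) j = 0"
  shows "(\<Sum>j\<le>Suc n. \<Sum>k\<le>n. h j k) = 0"
  using assms
proof (induction n)
  case 0
  then show ?case by simp
next
  case (Suc n)
  have "(\<Sum>j\<le>Suc (Suc n). \<Sum>k\<le>Suc n. h j k) =
      (\<Sum>j\<le>Suc n. \<Sum>k\<le>n. h j k) + ((\<Sum>j\<le>Suc n. h j (Suc n)) + (\<Sum>k\<le>Suc n. h (Suc (Suc n)) k))"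
    by (simp add: sum.distrib add.assoc)
  also have "(\<Sum>j\<le>Suc n. \<Sum>k\<le>n. h j k) = 0"
    using Suc by simp
  also have "(\<Sum>j\<le>Suc n. h j (Suc n)) + (\<Sum>k\<le>Suc n. h (Suc (Suc n)) k) =
      (\<Sum>j\<le>Suc n. h j (Suc n) + h (Suc (Suc n)) j)"
    by (simp only: sum.distrib)
  also have "\<dots> = 0"
    using Suc.prems by (intro sum.neutral) simp
  finally show ?case by simp
qed

text \<open>Passing from \<open>(j, k)\<close> to \<open>(Suc k, j)\<close> changes the parity of
  the exponent, so equal terms carry opposite signs.\<close>

lemma sum_frag_cmul_cancel:
  fixes h :: "nat \<Rightarrow> nat \<Rightarrow> 'a \<Rightarrow>\<^sub>0 int"
  assumes "\<And>j k. \<lbrakk>j \<le> k; k \<le> n\<rbrakk> \<Longrightarrow> h j k = h (Suc k) j"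
  shows "(\<Sum>j\<le>Suc n. \<Sum>k\<le>n. frag_cmul ((- 1) ^ j * (- 1) ^ k) (h j k)) = 0"
  using assms by (intro sum_sum_cancel) (simp add: frag_cmul_distrib[symmetric] mult.commute)

text \<open>Two insertions cancel already in the free group, before any tensor relation is
  imposed.\<close>

lemma amitsur_pre_amitsur_pre: "frag_extend (amitsur_pre B) (amitsur_pre B xs) = 0"
proof -
  let ?h = "\<lambda>j k. frag_of (insert_nth j \<one>\<^bsub>B\<^esub> (insert_nth k \<one>\<^bsub>B\<^esub> xs))"
  have "frag_extend (amitsur_pre B) (amitsur_pre B xs) =
      (\<Sum>k\<le>length xs. \<Sum>j\<le>Suc (length xs). frag_cmul ((- 1) ^ j * (- 1) ^ k) (?h j k))"
    by (simp only: amitsur_pre_def frag_extend_sum finite_atMost o_def frag_extend_cmul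
        frag_extend_of frag_cmul_sum frag_cmul_cmul insert_unit_eq length_insert_nth mult.commute)
  \<comment> \<open>The second insertion \<open>j\<close> has one more place available than the
    first one \<open>k\<close>, and \<open>sum_frag_cmul_cancel\<close> wants the longer range
    outside. For deletions the first one has the longer range, so \<open>boundary_boundary\<close>
    needs no interchange.\<close>
  also have "\<dots> = (\<Sum>j\<le>Suc (length xs). \<Sum>k\<le>length xs. frag_cmul ((- 1) ^ j * (- 1) ^ k) (?h j k))"
    by (rule sum.swap)
  also have "\<dots> = 0"
    by (rule sum_frag_cmul_cancel) (simp add: insert_nth_insert_nth)
  finally show ?thesis .
qed

text \<open>The simplicial boundary of an ordered subset as a formal sum, dual to \<open>d'\<close>:
  replacing each face \<open>\<zeta>\<close> by the image of \<open>x \<zeta>\<close> in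
  \<open>R \<eta>\<close> yields the \<open>\<eta>\<close>-component of \<open>d' x\<close>.\<close>

definition boundary :: "'i list \<Rightarrow> 'i list \<Rightarrow>\<^sub>0 int" where
  "boundary \<eta> = (\<Sum>k<length \<eta>. frag_cmul ((- 1) ^ k) (frag_of (delete_nth k \<eta>)))"

lemma boundary_boundary:
  assumes "length \<theta> = Suc (Suc n)"
  shows "frag_extend boundary (boundary \<theta>) = 0"
proof -
  have "frag_extend boundary (boundary \<theta>) =
      (\<Sum>j\<le>Suc n. frag_cmul ((- 1) ^ j) (boundary (delete_nth j \<theta>)))"
    by (simp add: boundary_def[of \<theta>] assms lessThan_Suc_atMost frag_extend_sum frag_extend_cmul
        del: sum.atMost_Suc)
  also have "\<dots> = (\<Sum>j\<le>Suc n. \<Sum>k\<le>n. frag_cmul ((- 1) ^ j * (- 1) ^ k)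
      (frag_of (delete_nth k (delete_nth j \<theta>))))"
    by (intro sum.cong refl)
      (simp add: boundary_def assms lessThan_Suc_atMost frag_cmul_sum del: sum.atMost_Suc)
  also have "\<dots> = 0"
    using assms by (intro sum_frag_cmul_cancel) (simp add: delete_nth_delete_nth)
  finally show ?thesis .
qed

text \<open>The bridge between the two kinds of sum: formal identities in the free abelian group
  become identities of \<open>finsum\<close> in \<open>G\<close>. Both \<open>d' d' = 0\<close> and
  the comparison with the Amitsur differential go through it.\<close>

lemma (in abelian_group) hom_free_sum:
  assumes F: "F \<in> hom (free_Abelian_group S) (add_monoid G)"
    and a: "\<And>k. k \<le> (m::nat) \<Longrightarrow> Poly_Mapping.keys (a k) \<subseteq> S"
  shows "F (\<Sum>k\<le>m. frag_cmul (z k) (a k)) = (\<Oplus>k\<in>{..m}. add_pow G (z k :: int) (F (a k)))"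
proof -
  interpret F: group_hom "free_Abelian_group S" "add_monoid G" F
    using F by (simp add: group_hom_def group_hom_axioms_def a_group)
  have closed: "F c \<in> carrier G" if "Poly_Mapping.keys c \<subseteq> S" for c
    using F.hom_closed[of c] that by simp
  have summand: "F (frag_cmul (z k) (a k)) = add_pow G (z k) (F (a k))" if "k \<le> m" for k
    using F.hom_int_pow[of "a k" "z k"] a[OF that] by (simp add: add_pow_def)
  show ?thesis
    using a summand
  proof (induction m)
    case 0
    then show ?case by (simp add: closed)
  next
    case (Suc m)
    have keys: "Poly_Mapping.keys (frag_cmul (z k) (a k)) \<subseteq> S" if "k \<le> Suc m" for k
      using keys_cmul Suc.prems(1)[OF that] by (rule order_trans)
    have sum: "Poly_Mapping.keys (\<Sum>k\<le>m. frag_cmul (z k) (a k)) \<subseteq> S"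
      using sum_closed_free_Abelian_group[of "{..m}" "\<lambda>k. frag_cmul (z k) (a k)" S] keys by simp
    have terms: "add_pow G (z k) (F (a k)) \<in> carrier G" if "k \<le> Suc m" for k
      using closed[OF Suc.prems(1)[OF that]] by simp
    have "F (\<Sum>k\<le>Suc m. frag_cmul (z k) (a k)) =
        F (\<Sum>k\<le>m. frag_cmul (z k) (a k)) \<oplus> F (frag_cmul (z (Suc m)) (a (Suc m)))"
      using F.hom_mult[of "\<Sum>k\<le>m. frag_cmul (z k) (a k)" "frag_cmul (z (Suc m)) (a (Suc m))"]
        sum keys[of "Suc m"] by simp
    also have "\<dots> = (\<Oplus>k\<in>{..m}. add_pow G (z k) (F (a k))) \<oplus> add_pow G (z (Suc m)) (F (a (Suc m)))"
      using Suc.IH Suc.prems by (simp del: add.int_pow_closed)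
    also have "\<dots> = (\<Oplus>k\<in>{..Suc m}. add_pow G (z k) (F (a k)))"
      using terms by (subst finsum_Suc) (auto intro!: a_comm finsum_closed)
    finally show ?case .
  qed
qed

text \<open>Serves to push a structure map \<open>r\<close>, regarded only as an additive map,
  through the inner signed sum of \<open>d' (d' x)\<close>.\<close>

lemma hom_finsum_add_pow:
  assumes "abelian_group G" "abelian_group H" and h: "h \<in> hom (add_monoid G) (add_monoid H)"
    and "finite A" "\<And>k. k \<in> A \<Longrightarrow> f k \<in> carrier G"
  shows "h (\<Oplus>\<^bsub>G\<^esub>k\<in>A. add_pow G (z k :: int) (f k)) = (\<Oplus>\<^bsub>H\<^esub>k\<in>A. add_pow H (z k) (h (f k)))"
  using assms(4,5)
proof (induction A rule: finite_induct)
  case empty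
  then show ?case
    using group_hom.hom_one[of "add_monoid G" "add_monoid H" h] assms(1-3)
    by (simp add: group_hom_def group_hom_axioms_def abelian_group.a_group
        abelian_monoid.finsum_empty abelian_group.axioms)
next
  case (insert k A)
  interpret G: abelian_group G by fact
  interpret H: abelian_group H by fact
  interpret h: group_hom "add_monoid G" "add_monoid H" h
    using h by (simp add: group_hom_def group_hom_axioms_def G.a_group H.a_group)
  have closed: "h y \<in> carrier H" if "y \<in> carrier G" for y
    using h.hom_closed[of y] that by simp
  have terms: "add_pow G (z i) (f i) \<in> carrier G" "add_pow H (z i) (h (f i)) \<in> carrier H"
    if "i \<in> insert k A" for i
    using insert.prems[OF that] closed by auto
  have "h (\<Oplus>\<^bsub>G\<^esub>i\<in>insert k A. add_pow G (z i) (f i)) =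
      h (add_pow G (z k) (f k) \<oplus>\<^bsub>G\<^esub> (\<Oplus>\<^bsub>G\<^esub>i\<in>A. add_pow G (z i) (f i)))"
    using insert.hyps terms by (subst G.finsum_insert) auto
  also have "\<dots> = h (add_pow G (z k) (f k)) \<oplus>\<^bsub>H\<^esub> h (\<Oplus>\<^bsub>G\<^esub>i\<in>A. add_pow G (z i) (f i))"
    using h.hom_mult[of "add_pow G (z k) (f k)" "\<Oplus>\<^bsub>G\<^esub>i\<in>A. add_pow G (z i) (f i)"] terms
    by (auto intro!: G.finsum_closed)
  also have "\<dots> = add_pow H (z k) (h (f k)) \<oplus>\<^bsub>H\<^esub> (\<Oplus>\<^bsub>H\<^esub>i\<in>A. add_pow H (z i) (h (f i)))"
    using h.hom_int_pow[of "f k" "z k"] insert.prems insert.IH by (simp add: add_pow_def)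
  also have "\<dots> = (\<Oplus>\<^bsub>H\<^esub>i\<in>insert k A. add_pow H (z i) (h (f i)))"
    using insert.hyps terms by (subst H.finsum_insert) auto
  finally show ?case .
qed

text \<open>Uniqueness half of the universal property: the elements on which two homomorphisms agree
  are closed under differences, and the generators suffice to build everything by
  differences.\<close>

lemma hom_free_Abelian_group_eq:
  assumes "group H" and F: "F \<in> hom (free_Abelian_group S) H" and G: "G \<in> hom (free_Abelian_group S) H"
    and of: "\<And>s. s \<in> S \<Longrightarrow> F (frag_of s) = G (frag_of s)"
    and c: "Poly_Mapping.keys c \<subseteq> S"
  shows "F c = G c"
proof -
  interpret F: group_hom "free_Abelian_group S" H F
    using F assms(1) by (simp add: group_hom_def group_hom_axioms_def)
  interpret G: group_hom "free_Abelian_group S" H G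
    using G assms(1) by (simp add: group_hom_def group_hom_axioms_def)
  show ?thesis
  proof (rule free_Abelian_group_induct[OF c])
    show "F 0 = G 0"
      using F.hom_one G.hom_one by simp
    show "F (x - y) = G (x - y)"
      if "Poly_Mapping.keys x \<subseteq> S" "Poly_Mapping.keys y \<subseteq> S" "F x = G x" "F y = G y" for x y
      using that F.hom_mult[of x "- y"] G.hom_mult[of x "- y"] F.hom_inv[of y] G.hom_inv[of y] by simp
  qed (rule of)
qed

lemma frag_cmul_diff_distrib2: "frag_cmul z (a - b) = frag_cmul z a - frag_cmul z b"
  by (rule poly_mapping_eqI) (simp add: lookup_minus right_diff_distrib)

lemma keys_diff_subset:
  "\<lbrakk>Poly_Mapping.keys a \<subseteq> S; Poly_Mapping.keys b \<subseteq> S\<rbrakk> \<Longrightarrow> Poly_Mapping.keys (a - b) \<subseteq> S"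
  using keys_diff[of a b] by blast

section \<open>The cochain complex of a functor on ordered subsets\<close>

lemma finite_level: "finite I \<Longrightarrow> finite (level I n)"
  unfolding level_def ordered_subsets_def
  by (rule finite_subset[OF _ finite_lists_length_eq[of I n]]) auto

lemma delete_nth_in_level:
  assumes "\<eta> \<in> level I (Suc n)" "k \<le> n"
  shows "delete_nth k \<eta> \<in> level I n"
proof -
  have "distinct (delete_nth k \<eta>)" "set (delete_nth k \<eta>) \<subseteq> set \<eta>"
    using assms set_take_disj_set_drop_if_distinct[of \<eta> k "Suc k"]
    by (auto simp: level_def ordered_subsets_def delete_nth_def dest: in_set_takeD in_set_dropD)
  then show ?thesis
    using assms by (auto simp: level_def ordered_subsets_def)
qed

lemma level_subseq_eq:
  assumes "\<eta> \<in> level I (Suc n)"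
  shows "{\<zeta> \<in> level I n. subseq \<zeta> \<eta>} = (\<lambda>k. delete_nth k \<eta>) ` {..n}"
proof -
  have len: "length \<eta> = Suc n"
    using assms by (simp add: level_def)
  have "\<zeta> \<in> (\<lambda>k. delete_nth k \<eta>) ` {..n}" if "\<zeta> \<in> level I n" and sub: "subseq \<zeta> \<eta>" for \<zeta>
  proof -
    have "length \<zeta> = n"
      using that by (simp add: level_def)
    then obtain k where "k < Suc n" "\<zeta> = delete_nth k \<eta>"
      using subseq_imp_delete_nth[OF sub] len by auto
    then show ?thesis
      by simp
  qed
  moreover have "delete_nth k \<eta> \<in> {\<zeta> \<in> level I n. subseq \<zeta> \<eta>}" if "k \<le> n" for k
    using delete_nth_in_level[OF assms that] subseq_delete_nth by simp
  ultimately show ?thesis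
    by (intro subset_antisym subsetI) (elim CollectE conjE imageE; simp)+
qed

locale functor_complex =
  fixes I :: "'i set" and R :: "'i list \<Rightarrow> ('r, 'm) ring_scheme" and r :: "'i list \<Rightarrow> 'i list \<Rightarrow> 'r \<Rightarrow> 'r"
  assumes finite_index: "finite I"
    and is_functor: "ordered_subset_functor I R r"
begin

section \<open>Structure maps and the groups \<open>S^n\<close>\<close>

lemma ring_R: "\<zeta> \<in> ordered_subsets I \<Longrightarrow> ring (R \<zeta>)"
  using is_functor by (simp add: ordered_subset_functor_def)

lemma ring_level: "\<zeta> \<in> level I n \<Longrightarrow> ring (R \<zeta>)"
  by (simp add: level_def ring_R)

lemma hom_r:
  "\<lbrakk>\<zeta> \<in> ordered_subsets I; \<theta> \<in> ordered_subsets I; subseq \<zeta> \<theta>\<rbrakk> \<Longrightarrow> r \<zeta> \<theta> \<in> ring_hom (R \<zeta>) (R \<theta>)"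
  using is_functor by (simp add: ordered_subset_functor_def)

lemma r_comp:
  "\<lbrakk>\<zeta> \<in> ordered_subsets I; \<eta> \<in> ordered_subsets I; \<theta> \<in> ordered_subsets I;
    subseq \<zeta> \<eta>; subseq \<eta> \<theta>; x \<in> carrier (R \<zeta>)\<rbrakk> \<Longrightarrow> r \<eta> \<theta> (r \<zeta> \<eta> x) = r \<zeta> \<theta> x"
  using is_functor by (simp add: ordered_subset_functor_def)

lemma hom_r_delete_nth:
  assumes "\<eta> \<in> level I (Suc n)" "k \<le> n"
  shows "r (delete_nth k \<eta>) \<eta> \<in> ring_hom (R (delete_nth k \<eta>)) (R \<eta>)"
  using delete_nth_in_level[OF assms] assms(1)
  by (intro hom_r subseq_delete_nth) (auto simp: level_def)

text \<open>As \<open>I\<close> is finite, each level is finite, so the finite support demanded by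
  \<open>sum_group\<close> is automatic and the direct sum is the full product.\<close>

lemma carrier_functor_group: "carrier (functor_group I R n) = (\<Pi>\<^sub>E \<zeta>\<in>level I n. carrier (R \<zeta>))"
  unfolding functor_group_def
  using finite_level[OF finite_index, of n]
  by (subst carrier_sum_group) (auto simp: abelian_group.a_group ring.is_abelian_group ring_level)

lemma one_functor_group: "\<one>\<^bsub>functor_group I R n\<^esub> = (\<lambda>\<zeta>\<in>level I n. \<zero>\<^bsub>R \<zeta>\<^esub>)"
  by (simp add: functor_group_def)

lemma mult_functor_group:
  "x \<otimes>\<^bsub>functor_group I R n\<^esub> y = (\<lambda>\<zeta>\<in>level I n. x \<zeta> \<oplus>\<^bsub>R \<zeta>\<^esub> y \<zeta>)"
  by (simp add: functor_group_def)

lemma comm_group_functor_group: "comm_group (functor_group I R n)"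
proof (rule group.group_comm_groupI)
  show "group (functor_group I R n)"
    unfolding functor_group_def
    by (intro sum_group) (auto simp: abelian_group.a_group ring.is_abelian_group ring_level)
  show "x \<otimes>\<^bsub>functor_group I R n\<^esub> y = y \<otimes>\<^bsub>functor_group I R n\<^esub> x"
    if "x \<in> carrier (functor_group I R n)" "y \<in> carrier (functor_group I R n)" for x y
    using that unfolding mult_functor_group carrier_functor_group
    by (intro restrict_ext)
      (auto simp: PiE_iff intro!: abelian_monoid.a_comm abelian_group.axioms ring.is_abelian_group ring_level)
qed

lemma component_hom:
  assumes "\<zeta> \<in> level I n"
  shows "(\<lambda>x. x \<zeta>) \<in> hom (functor_group I R n) (add_monoid (R \<zeta>))"
  using assms by (intro homI) (auto simp: carrier_functor_group mult_functor_group)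

text \<open>This exhibits \<open>d'\<close> as an alternating sum of cofaces. The ordered subsets
  one step below \<open>\<eta>\<close> are its faces, listed injectively by the deleted position
  because \<open>\<eta>\<close> has no repetition, and \<open>gap\<close> returns that position,
  which fixes the sign.\<close>

lemma functor_diff_eq:
  assumes "\<eta> \<in> level I (Suc n)" "x \<in> carrier (functor_group I R n)"
  shows "functor_diff I R r n x \<eta> =
    (\<Oplus>\<^bsub>R \<eta>\<^esub>k\<in>{..n}. add_pow (R \<eta>) ((- 1) ^ k :: int) (r (delete_nth k \<eta>) \<eta> (x (delete_nth k \<eta>))))"
proof -
  interpret R: ring "R \<eta>"
    using assms ring_level by blast
  have \<eta>: "distinct \<eta>" "length \<eta> = Suc n"
    using assms by (auto simp: level_def ordered_subsets_def)
  have closed: "r (delete_nth k \<eta>) \<eta> (x (delete_nth k \<eta>)) \<in> carrier (R \<eta>)" if "k \<le> n" for k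
    using hom_r_delete_nth[OF assms(1) that] delete_nth_in_level[OF assms(1) that] assms(2)
    by (auto simp: carrier_functor_group intro: ring_hom_closed)
  have gap: "gap \<eta> (delete_nth k \<eta>) = k" if "k \<le> n" for k
    using \<eta> that by (simp add: gap_delete_nth)
  have inj: "inj_on (\<lambda>k. delete_nth k \<eta>) {..n}"
    using inj_on_delete_nth[of \<eta>] \<eta> by (simp add: lessThan_Suc_atMost)
  have "functor_diff I R r n x \<eta> = finsum (R \<eta>)
      (\<lambda>\<zeta>. add_pow (R \<eta>) ((- 1) ^ gap \<eta> \<zeta> :: int) (r \<zeta> \<eta> (x \<zeta>))) ((\<lambda>k. delete_nth k \<eta>) ` {..n})"
    using assms(1) by (simp add: functor_diff_def level_subseq_eq)
  also have "\<dots> = (\<Oplus>\<^bsub>R \<eta>\<^esub>k\<in>{..n}. add_pow (R \<eta>) ((- 1) ^ gap \<eta> (delete_nth k \<eta>) :: int)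
      (r (delete_nth k \<eta>) \<eta> (x (delete_nth k \<eta>))))"
    using inj closed by (intro R.finsum_reindex) auto
  also have "\<dots> = (\<Oplus>\<^bsub>R \<eta>\<^esub>k\<in>{..n}. add_pow (R \<eta>) ((- 1) ^ k :: int)
      (r (delete_nth k \<eta>) \<eta> (x (delete_nth k \<eta>))))"
    using closed gap by (intro R.finsum_cong') auto
  finally show ?thesis .
qed

lemma functor_diff_hom:
  "functor_diff I R r n \<in> hom (functor_group I R n) (functor_group I R (Suc n))"
proof (rule homI)
  have r_closed: "r (delete_nth k \<eta>) \<eta> (x (delete_nth k \<eta>)) \<in> carrier (R \<eta>)"
    if "\<eta> \<in> level I (Suc n)" "k \<le> n" "x \<in> carrier (functor_group I R n)" for k \<eta> x
    using hom_r_delete_nth[OF that(1,2)] delete_nth_in_level[OF that(1,2)] that(3)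
    by (auto simp: carrier_functor_group intro: ring_hom_closed)
  show closed: "functor_diff I R r n x \<in> carrier (functor_group I R (Suc n))"
    if x: "x \<in> carrier (functor_group I R n)" for x
  proof -
    have "functor_diff I R r n x \<eta> \<in> carrier (R \<eta>)" if "\<eta> \<in> level I (Suc n)" for \<eta>
    proof -
      interpret R: ring "R \<eta>"
        using that ring_level by blast
      show ?thesis
        using r_closed x that by (auto simp: functor_diff_eq intro!: R.finsum_closed)
    qed
    then show ?thesis
      by (auto simp: carrier_functor_group functor_diff_def)
  qed
  show "functor_diff I R r n (x \<otimes>\<^bsub>functor_group I R n\<^esub> y) =
      functor_diff I R r n x \<otimes>\<^bsub>functor_group I R (Suc n)\<^esub> functor_diff I R r n y"
    if xy: "x \<in> carrier (functor_group I R n)" "y \<in> carrier (functor_group I R n)" for x y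
  proof -
    have add: "functor_diff I R r n (x \<otimes>\<^bsub>functor_group I R n\<^esub> y) \<eta> =
        functor_diff I R r n x \<eta> \<oplus>\<^bsub>R \<eta>\<^esub> functor_diff I R r n y \<eta>" if \<eta>: "\<eta> \<in> level I (Suc n)" for \<eta>
    proof -
      interpret R: ring "R \<eta>"
        using \<eta> ring_level by blast
      let ?r = "\<lambda>k. r (delete_nth k \<eta>) \<eta>"
      have "?r k ((x \<otimes>\<^bsub>functor_group I R n\<^esub> y) (delete_nth k \<eta>)) =
          ?r k (x (delete_nth k \<eta>)) \<oplus>\<^bsub>R \<eta>\<^esub> ?r k (y (delete_nth k \<eta>))" if "k \<le> n" for k
        using delete_nth_in_level[OF \<eta> that] hom_r_delete_nth[OF \<eta> that] xy
        by (auto simp: mult_functor_group carrier_functor_group intro!: ring_hom_add)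
      then have summand: "add_pow (R \<eta>) ((- 1) ^ k :: int) (?r k ((x \<otimes>\<^bsub>functor_group I R n\<^esub> y) (delete_nth k \<eta>))) =
          add_pow (R \<eta>) ((- 1) ^ k :: int) (?r k (x (delete_nth k \<eta>))) \<oplus>\<^bsub>R \<eta>\<^esub>
          add_pow (R \<eta>) ((- 1) ^ k :: int) (?r k (y (delete_nth k \<eta>)))" if "k \<le> n" for k
        using that r_closed[OF \<eta> that xy(1)] r_closed[OF \<eta> that xy(2)]
        by (simp add: R.add.int_pow_mult_distrib R.a_comm)
      have "functor_diff I R r n (x \<otimes>\<^bsub>functor_group I R n\<^esub> y) \<eta> =
          (\<Oplus>\<^bsub>R \<eta>\<^esub>k\<in>{..n}. add_pow (R \<eta>) ((- 1) ^ k :: int) (?r k (x (delete_nth k \<eta>))) \<oplus>\<^bsub>R \<eta>\<^esub>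
            add_pow (R \<eta>) ((- 1) ^ k :: int) (?r k (y (delete_nth k \<eta>))))"
        unfolding functor_diff_eq[OF \<eta> comm_group_functor_group[THEN comm_groupE(1), OF xy]]
        using summand r_closed[OF \<eta> _ xy(1)] r_closed[OF \<eta> _ xy(2)] by (intro R.finsum_cong') auto
      also have "\<dots> = functor_diff I R r n x \<eta> \<oplus>\<^bsub>R \<eta>\<^esub> functor_diff I R r n y \<eta>"
        unfolding functor_diff_eq[OF \<eta> xy(1)] functor_diff_eq[OF \<eta> xy(2)]
        using r_closed[OF \<eta> _ xy(1)] r_closed[OF \<eta> _ xy(2)] by (intro R.finsum_addf) auto
      finally show ?thesis .
    qed
    \<comment> \<open>Outside the level both sides are \<open>undefined\<close>, so after this
      restriction the componentwise identity \<open>add\<close> suffices.\<close>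
    have "functor_diff I R r n (x \<otimes>\<^bsub>functor_group I R n\<^esub> y) =
        (\<lambda>\<eta>\<in>level I (Suc n). functor_diff I R r n (x \<otimes>\<^bsub>functor_group I R n\<^esub> y) \<eta>)"
      unfolding functor_diff_def by (rule ext) simp
    also have "\<dots> = functor_diff I R r n x \<otimes>\<^bsub>functor_group I R (Suc n)\<^esub> functor_diff I R r n y"
      unfolding mult_functor_group by (intro restrict_ext) (rule add[unfolded mult_functor_group])
    finally show ?thesis .
  qed
qed

text \<open>All components of \<open>x\<close> that contribute to the \<open>\<theta>\<close>-component of \<open>d' (d' x)\<close> are pushed
  into \<open>R \<theta>\<close>, so that \<open>d' (d' x)\<close> becomes a homomorphic image of the double boundary of \<open>\<theta>\<close> in a
  free Abelian group.\<close>

lemma functor_diff_functor_diff: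
  assumes x: "x \<in> carrier (functor_group I R n)"
  shows "functor_diff I R r (Suc n) (functor_diff I R r n x) = \<one>\<^bsub>functor_group I R (Suc (Suc n))\<^esub>"
proof -
  have "functor_diff I R r (Suc n) (functor_diff I R r n x) \<theta> = \<zero>\<^bsub>R \<theta>\<^esub>"
    if \<theta>: "\<theta> \<in> level I (Suc (Suc n))" for \<theta>
  proof -
    interpret R: ring "R \<theta>"
      using \<theta> ring_level by blast
    have len: "length \<theta> = Suc (Suc n)"
      using \<theta> by (simp add: level_def)
    define S where "S = {\<zeta> \<in> level I n. subseq \<zeta> \<theta>}"
    have "r \<zeta> \<theta> (x \<zeta>) \<in> carrier (R \<theta>)" if "\<zeta> \<in> S" for \<zeta>
    proof (rule ring_hom_closed[where h = "r \<zeta> \<theta>" and x = "x \<zeta>" and R = "R \<zeta>"])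
      show "r \<zeta> \<theta> \<in> ring_hom (R \<zeta>) (R \<theta>)"
        using \<theta> that by (intro hom_r) (auto simp: S_def level_def)
      show "x \<zeta> \<in> carrier (R \<zeta>)"
        using x that by (auto simp: S_def carrier_functor_group)
    qed
    then have "(\<lambda>\<zeta>. r \<zeta> \<theta> (x \<zeta>)) ` S \<subseteq> carrier (add_monoid (R \<theta>))"
      by auto
    \<comment> \<open>The universal property extends the evaluation of \<open>x\<close> at the
      codimension-two faces of \<open>\<theta>\<close>, transported into \<open>R \<theta>\<close>,
      to formal sums of such faces.\<close>
    then obtain e where e: "e \<in> hom (free_Abelian_group S) (add_monoid (R \<theta>))"
      and e_of: "\<And>\<zeta>. \<zeta> \<in> S \<Longrightarrow> e (frag_of \<zeta>) = r \<zeta> \<theta> (x \<zeta>)"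
      by (rule comm_group.free_Abelian_group_universal[OF R.a_comm_group]) blast
    have face: "r (delete_nth j \<theta>) \<theta> (functor_diff I R r n x (delete_nth j \<theta>)) =
        e (boundary (delete_nth j \<theta>)) \<and> Poly_Mapping.keys (boundary (delete_nth j \<theta>)) \<subseteq> S"
      if j: "j \<le> Suc n" for j
    proof -
      let ?\<eta> = "delete_nth j \<theta>"
      have \<eta>: "?\<eta> \<in> level I (Suc n)"
        using delete_nth_in_level[OF \<theta> j] .
      have ord: "?\<eta> \<in> ordered_subsets I" "\<theta> \<in> ordered_subsets I"
        using \<eta> \<theta> by (auto simp: level_def)
      have abel: "abelian_group (R ?\<eta>)" "abelian_group (R \<theta>)"
        using ord ring_R ring.is_abelian_group by blast+
      have r_add: "r ?\<eta> \<theta> \<in> hom (add_monoid (R ?\<eta>)) (add_monoid (R \<theta>))"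
        using hom_r_delete_nth[OF \<theta> j] by (auto simp: ring_hom_def hom_def)
      have len\<eta>: "length ?\<eta> = Suc n"
        using len j by simp
      have sub: "delete_nth k ?\<eta> \<in> S" if "k \<le> n" for k
        using delete_nth_in_level[OF \<eta> that] subseq_delete_nth subseq_order.order_trans
        unfolding S_def by blast
      \<comment> \<open>By functoriality the contribution of a face of a face does not depend on the
        intermediate \<open>?\<eta>\<close>. It is thus the value of \<open>e\<close> on a
        generator, and the face identities can be used on generators.\<close>
      have comp: "r ?\<eta> \<theta> (r (delete_nth k ?\<eta>) ?\<eta> (x (delete_nth k ?\<eta>))) = e (frag_of (delete_nth k ?\<eta>))"
        and inner: "r (delete_nth k ?\<eta>) ?\<eta> (x (delete_nth k ?\<eta>)) \<in> carrier (R ?\<eta>)" if "k \<le> n" for k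
      proof -
        have lev: "delete_nth k ?\<eta> \<in> level I n"
          using delete_nth_in_level[OF \<eta> that] .
        have x': "x (delete_nth k ?\<eta>) \<in> carrier (R (delete_nth k ?\<eta>))"
          using x lev by (auto simp: carrier_functor_group)
        show "r (delete_nth k ?\<eta>) ?\<eta> (x (delete_nth k ?\<eta>)) \<in> carrier (R ?\<eta>)"
          using hom_r_delete_nth[OF \<eta> that] x' by (rule ring_hom_closed)
        have "r ?\<eta> \<theta> (r (delete_nth k ?\<eta>) ?\<eta> (x (delete_nth k ?\<eta>))) = r (delete_nth k ?\<eta>) \<theta> (x (delete_nth k ?\<eta>))"
          using lev ord x' by (intro r_comp subseq_delete_nth) (auto simp: level_def)
        then show "r ?\<eta> \<theta> (r (delete_nth k ?\<eta>) ?\<eta> (x (delete_nth k ?\<eta>))) = e (frag_of (delete_nth k ?\<eta>))"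
          by (simp add: e_of sub that)
      qed
      have e_closed: "e (frag_of \<zeta>) \<in> carrier (R \<theta>)" if "\<zeta> \<in> S" for \<zeta>
        using hom_in_carrier[OF e, of "frag_of \<zeta>"] that by simp
      have "r ?\<eta> \<theta> (functor_diff I R r n x ?\<eta>) = (\<Oplus>\<^bsub>R \<theta>\<^esub>k\<in>{..n}.
          add_pow (R \<theta>) ((- 1) ^ k :: int) (r ?\<eta> \<theta> (r (delete_nth k ?\<eta>) ?\<eta> (x (delete_nth k ?\<eta>)))))"
        unfolding functor_diff_eq[OF \<eta> x]
        using inner by (intro hom_finsum_add_pow abel r_add) auto
      also have "\<dots> = (\<Oplus>\<^bsub>R \<theta>\<^esub>k\<in>{..n}. add_pow (R \<theta>) ((- 1) ^ k :: int) (e (frag_of (delete_nth k ?\<eta>))))"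
        using sub e_closed by (intro R.finsum_cong') (auto simp: comp)
      also have "\<dots> = e (\<Sum>k\<le>n. frag_cmul ((- 1) ^ k) (frag_of (delete_nth k ?\<eta>)))"
        using sub by (intro R.hom_free_sum[OF e, symmetric]) auto
      also have "(\<Sum>k\<le>n. frag_cmul ((- 1) ^ k) (frag_of (delete_nth k ?\<eta>))) = boundary ?\<eta>"
        by (simp only: boundary_def len\<eta> lessThan_Suc_atMost)
      finally have eq: "r ?\<eta> \<theta> (functor_diff I R r n x ?\<eta>) = e (boundary ?\<eta>)" .
      have "Poly_Mapping.keys (frag_cmul ((- 1) ^ k) (frag_of (delete_nth k ?\<eta>))) \<subseteq> S" if "k \<le> n" for k
        using sub[OF that] by auto
      then have "boundary ?\<eta> \<in> carrier (free_Abelian_group S)"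
        unfolding boundary_def len\<eta> by (intro sum_closed_free_Abelian_group) auto
      with eq show ?thesis
        by simp
    qed
    have e_closed: "e (boundary (delete_nth j \<theta>)) \<in> carrier (R \<theta>)" if "j \<le> Suc n" for j
      using hom_in_carrier[OF e, of "boundary (delete_nth j \<theta>)"] face[OF that] by simp
    have "functor_diff I R r (Suc n) (functor_diff I R r n x) \<theta> = (\<Oplus>\<^bsub>R \<theta>\<^esub>j\<in>{..Suc n}.
        add_pow (R \<theta>) ((- 1) ^ j :: int) (r (delete_nth j \<theta>) \<theta> (functor_diff I R r n x (delete_nth j \<theta>))))"
      using functor_diff_eq[OF \<theta> hom_in_carrier[OF functor_diff_hom x]] .
    also have "\<dots> = (\<Oplus>\<^bsub>R \<theta>\<^esub>j\<in>{..Suc n}. add_pow (R \<theta>) ((- 1) ^ j :: int) (e (boundary (delete_nth j \<theta>))))"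
      using face e_closed by (intro R.finsum_cong') auto
    also have "\<dots> = e (\<Sum>j\<le>Suc n. frag_cmul ((- 1) ^ j) (boundary (delete_nth j \<theta>)))"
      using face by (intro R.hom_free_sum[OF e, symmetric]) auto
    also have "(\<Sum>j\<le>Suc n. frag_cmul ((- 1) ^ j) (boundary (delete_nth j \<theta>))) = frag_extend boundary (boundary \<theta>)"
      by (simp add: boundary_def[of \<theta>] len lessThan_Suc_atMost frag_extend_sum frag_extend_cmul
        del: sum.atMost_Suc)
    also have "\<dots> = 0"
      using len by (rule boundary_boundary)
    also have "e 0 = \<zero>\<^bsub>R \<theta>\<^esub>"
      using hom_one[OF e] R.a_group by simp
    finally show ?thesis .
  qed
  then show ?thesis
    by (auto simp: one_functor_group functor_diff_def[of I R r "Suc n"] intro!: restrict_ext)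
qed

lemma cochain_complex_functor_group: "cochain_complex (functor_group I R) (functor_diff I R r)"
  by (simp add: cochain_complex_def comm_group_functor_group functor_diff_hom functor_diff_functor_diff)

end

section \<open>The Amitsur complex of a ring extension\<close>

locale ring_extension = A?: ring A + B: ring B
  for A :: "('a, 'c) ring_scheme" and B :: "('b, 'd) ring_scheme" +
  fixes f :: "'a \<Rightarrow> 'b"
  assumes hom_f: "f \<in> ring_hom A B"
begin

abbreviation "gens \<equiv> tensor_gens B"
abbreviation "null \<equiv> tensor_null A B f"
abbreviation "tens \<equiv> tensor_power A B f"
abbreviation "cls \<equiv> tensor_class A B f"

section \<open>Tensor powers as quotients of free abelian groups\<close>

lemma tensor_gens_append_Cons:
  "us @ b # vs \<in> gens n \<longleftrightarrow>
    length us + Suc (length vs) = n \<and> set us \<subseteq> carrier B \<and> b \<in> carrier B \<and> set vs \<subseteq> carrier B"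
  by (auto simp: tensor_gens_def)

lemma f_closed: "a \<in> carrier A \<Longrightarrow> f a \<in> carrier B"
  using hom_f by (rule ring_hom_closed)

lemma tensor_rels_subset: "tensor_rels A B f n \<subseteq> carrier (free_Abelian_group (gens n))"
  unfolding tensor_rels_def
  by (auto simp: tensor_gens_append_Cons f_closed keys_diff_subset simp del: keys_diff
      intro!: keys_diff_subset)

lemma subgroup_tensor_null: "subgroup (null n) (free_Abelian_group (gens n))"
  unfolding tensor_null_def
  by (intro group.generate_is_subgroup group_free_Abelian_group tensor_rels_subset)

lemma normal_tensor_null: "null n \<lhd> free_Abelian_group (gens n)"
  by (intro comm_group.subgroup_imp_normal abelian_free_Abelian_group subgroup_tensor_null)

lemma rel_in_tensor_null: "c \<in> tensor_rels A B f n \<Longrightarrow> c \<in> null n"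
  unfolding tensor_null_def by (rule generate.incl)

lemma additive_rel:
  assumes "us @ [b] @ vs \<in> gens n" "c \<in> carrier B"
  shows "frag_of (us @ [b \<oplus>\<^bsub>B\<^esub> c] @ vs) - frag_of (us @ [b] @ vs) - frag_of (us @ [c] @ vs) \<in> null n"
  using assms by (intro rel_in_tensor_null) (unfold tensor_rels_def, blast)

lemma balanced_rel:
  assumes "us @ [b, c] @ vs \<in> gens n" "a \<in> carrier A"
  shows "frag_of (us @ [b \<otimes>\<^bsub>B\<^esub> f a, c] @ vs) - frag_of (us @ [b, f a \<otimes>\<^bsub>B\<^esub> c] @ vs) \<in> null n"
  using assms by (intro rel_in_tensor_null) (unfold tensor_rels_def, blast)

lemma tensor_null_zero: "0 \<in> null n"
  using subgroup.one_closed[OF subgroup_tensor_null] by simp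

lemma tensor_null_add: "\<lbrakk>a \<in> null n; b \<in> null n\<rbrakk> \<Longrightarrow> a + b \<in> null n"
  using subgroup.m_closed[OF subgroup_tensor_null] by simp

lemma tensor_null_diff:
  assumes "a \<in> null n" "b \<in> null n"
  shows "a - b \<in> null n"
proof -
  have "Poly_Mapping.keys b \<subseteq> gens n"
    using subgroup.mem_carrier[OF subgroup_tensor_null assms(2)] by simp
  then have "- b \<in> null n"
    using subgroup.m_inv_closed[OF subgroup_tensor_null assms(2)] by simp
  then show ?thesis
    using tensor_null_add[OF assms(1)] by fastforce
qed

lemma tensor_null_cmul: "a \<in> null n \<Longrightarrow> frag_cmul z a \<in> null n"
  by (rule frag_closure_minus_cmul) (auto simp: tensor_null_zero tensor_null_diff)

lemma tensor_null_sum: "(\<And>k. k \<in> K \<Longrightarrow> h k \<in> null n) \<Longrightarrow> (\<Sum>k\<in>K. h k) \<in> null n"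
  by (induction K rule: infinite_finite_induct) (auto simp: tensor_null_zero tensor_null_add)

lemma tensor_class_hom: "cls n \<in> hom (free_Abelian_group (gens n)) (tens n)"
  unfolding tensor_power_def tensor_class_def
  using normal.r_coset_hom_Mod[OF normal_tensor_null] .

lemma comm_group_tensor_power: "comm_group (tens n)"
  unfolding tensor_power_def
  by (intro comm_group.abelian_FactGroup abelian_free_Abelian_group subgroup_tensor_null)

lemma tensor_class_null:
  assumes "c \<in> null n"
  shows "cls n c = \<one>\<^bsub>tens n\<^esub>"
  using assms subgroup.rcos_const[OF subgroup_tensor_null]
  by (simp add: tensor_class_def tensor_power_def)

lemma tensor_class_add:
  assumes "Poly_Mapping.keys a \<subseteq> gens n" "Poly_Mapping.keys b \<subseteq> gens n"
  shows "cls n (a + b) = cls n a \<otimes>\<^bsub>tens n\<^esub> cls n b"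
  using hom_mult[OF tensor_class_hom, of a n b] assms by simp

lemma tensor_class_eqI:
  assumes "a - b \<in> null n" "Poly_Mapping.keys a \<subseteq> gens n" "Poly_Mapping.keys b \<subseteq> gens n"
  shows "cls n a = cls n b"
proof -
  have "cls n (a - b + b) = cls n (a - b) \<otimes>\<^bsub>tens n\<^esub> cls n b"
    using assms by (intro tensor_class_add keys_diff_subset)
  then show ?thesis
    using assms hom_in_carrier[OF tensor_class_hom, of b n] comm_groupE(5)[OF comm_group_tensor_power]
    by (simp add: tensor_class_null)
qed

lemma tensor_power_cases:
  assumes "T \<in> carrier (tens n)"
  obtains c where "Poly_Mapping.keys c \<subseteq> gens n" "T = cls n c"
  using assms unfolding tensor_power_def tensor_class_def carrier_FactGroup by auto

lemma pure_tensor_in_carrier: "xs \<in> gens n \<Longrightarrow> pure_tensor A B f xs \<in> carrier (tens n)"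
  using hom_in_carrier[OF tensor_class_hom, of "frag_of xs" n]
  by (simp add: pure_tensor_def tensor_gens_def)

lemma pure_tensor_add:
  assumes "us @ b # vs \<in> gens n" "c \<in> carrier B"
  shows "pure_tensor A B f (us @ (b \<oplus>\<^bsub>B\<^esub> c) # vs) =
    pure_tensor A B f (us @ b # vs) \<otimes>\<^bsub>tens n\<^esub> pure_tensor A B f (us @ c # vs)"
proof -
  have n: "n = Suc (length us + length vs)"
    using assms by (simp add: tensor_gens_append_Cons)
  have "frag_of (us @ (b \<oplus>\<^bsub>B\<^esub> c) # vs) - frag_of (us @ b # vs) - frag_of (us @ c # vs) \<in> null n"
    using additive_rel[of us b vs n c] assms by simp
  moreover have "us @ (b \<oplus>\<^bsub>B\<^esub> c) # vs \<in> gens n" "us @ c # vs \<in> gens n"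
    using assms by (auto simp: tensor_gens_append_Cons)
  ultimately have "cls n (frag_of (us @ (b \<oplus>\<^bsub>B\<^esub> c) # vs)) = cls n (frag_of (us @ b # vs) + frag_of (us @ c # vs))"
    using assms keys_add[of "frag_of (us @ b # vs)" "frag_of (us @ c # vs)"]
    by (intro tensor_class_eqI) (auto simp: diff_diff_eq)
  also have "\<dots> = cls n (frag_of (us @ b # vs)) \<otimes>\<^bsub>tens n\<^esub> cls n (frag_of (us @ c # vs))"
    using assms \<open>us @ c # vs \<in> gens n\<close> by (intro tensor_class_add) auto
  finally show ?thesis
    by (simp add: pure_tensor_def n)
qed

text \<open>Additivity in one slot with the others frozen. It is used to split an arbitrary entry of
  a tensor into its components, and again to split the inserted unit.\<close>

lemma pure_tensor_hom:
  assumes "set us \<subseteq> carrier B" "set vs \<subseteq> carrier B" "length us + Suc (length vs) = n"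
  shows "(\<lambda>b. pure_tensor A B f (us @ b # vs)) \<in> hom (add_monoid B) (tens n)"
  using assms by (intro homI) (auto simp: tensor_gens_append_Cons pure_tensor_add pure_tensor_in_carrier)

text \<open>Composing with the quotient map reduces the claim to free generators, whose classes are
  the pure tensors.\<close>

lemma hom_eq_on_tensor_power:
  assumes "group H" and F: "F \<in> hom (tens n) H" and G: "G \<in> hom (tens n) H"
    and pure: "\<And>xs. xs \<in> gens n \<Longrightarrow> F (pure_tensor A B f xs) = G (pure_tensor A B f xs)"
    and T: "T \<in> carrier (tens n)"
  shows "F T = G T"
proof -
  obtain c where c: "Poly_Mapping.keys c \<subseteq> gens n" and T: "T = cls n c"
    using T by (rule tensor_power_cases)
  have "(F \<circ> cls n) c = (G \<circ> cls n) c"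
  proof (rule hom_free_Abelian_group_eq[OF assms(1) _ _ _ c])
    show "F \<circ> cls n \<in> hom (free_Abelian_group (gens n)) H" "G \<circ> cls n \<in> hom (free_Abelian_group (gens n)) H"
      using tensor_class_hom F G by (auto intro: hom_compose)
    show "(F \<circ> cls n) (frag_of xs) = (G \<circ> cls n) (frag_of xs)" if "xs \<in> gens n" for xs
      using pure[OF that] that by (simp add: pure_tensor_def tensor_gens_def)
  qed
  with T show ?thesis by simp
qed

section \<open>Descent of the Amitsur differential to the tensor powers\<close>

lemma amitsur_pre_keys:
  assumes "xs \<in> gens n"
  shows "Poly_Mapping.keys (amitsur_pre B xs) \<subseteq> gens (Suc n)"
proof -
  have "insert_nth k \<one>\<^bsub>B\<^esub> xs \<in> gens (Suc n)" for k
    using assms by (auto simp: tensor_gens_def)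
  then have "amitsur_pre B xs \<in> carrier (free_Abelian_group (gens (Suc n)))"
    unfolding amitsur_pre_def insert_unit_eq by (intro sum_closed_free_Abelian_group) auto
  then show ?thesis by simp
qed

lemma amitsur_extend_hom:
  "frag_extend (amitsur_pre B) \<in> hom (free_Abelian_group (gens n)) (free_Abelian_group (gens (Suc n)))"
proof (rule homI)
  show "frag_extend (amitsur_pre B) c \<in> carrier (free_Abelian_group (gens (Suc n)))"
    if "c \<in> carrier (free_Abelian_group (gens n))" for c
    using that keys_frag_extend[of "amitsur_pre B" c] amitsur_pre_keys by fastforce
qed (simp add: frag_extend_add)

lemma amitsur_extend_additive_rel:
  assumes gens: "us @ [b] @ vs \<in> gens n" and c: "c \<in> carrier B"
  shows "frag_extend (amitsur_pre B)
    (frag_of (us @ [b \<oplus>\<^bsub>B\<^esub> c] @ vs) - frag_of (us @ [b] @ vs) - frag_of (us @ [c] @ vs)) \<in> null (Suc n)"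
proof -
  define g where "g k x = frag_of (insert_nth k \<one>\<^bsub>B\<^esub> (us @ [x] @ vs))" for k x
  have rel: "g k (b \<oplus>\<^bsub>B\<^esub> c) - g k b - g k c \<in> null (Suc n)" for k
  proof -
    obtain us' vs' where "set us' \<subseteq> carrier B" "set vs' \<subseteq> carrier B" "length us' + length vs' = n"
      "\<And>x. insert_nth k \<one>\<^bsub>B\<^esub> (us @ [x] @ vs) = us' @ [x] @ vs'"
    proof (cases "k \<le> length us")
      case True
      with gens show thesis
        by (intro that[of "insert_nth k \<one>\<^bsub>B\<^esub> us" vs])
          (auto simp: insert_nth_append_left tensor_gens_append_Cons)
    next
      case False
      with gens show thesis
        by (intro that[of us "insert_nth (k - length us - 1) \<one>\<^bsub>B\<^esub> vs"])
          (auto simp: insert_nth_append_right insert_nth_append_right[of "[x]" for x, simplified]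
            tensor_gens_append_Cons)
    qed
    with gens c show ?thesis
      unfolding g_def by (simp only:) (intro additive_rel; simp add: tensor_gens_append_Cons)
  qed
  have "length (us @ [x] @ vs) = n" for x
    using gens by (simp add: tensor_gens_def)
  then have "frag_extend (amitsur_pre B)
      (frag_of (us @ [b \<oplus>\<^bsub>B\<^esub> c] @ vs) - frag_of (us @ [b] @ vs) - frag_of (us @ [c] @ vs)) =
    (\<Sum>k\<le>n. frag_cmul ((- 1) ^ k) (g k (b \<oplus>\<^bsub>B\<^esub> c) - g k b - g k c))"
    by (simp only: frag_extend_diff frag_extend_of amitsur_pre_def insert_unit_eq g_def
        frag_cmul_diff_distrib2 sum_subtractf)
  with rel show ?thesis
    by (simp add: tensor_null_sum tensor_null_cmul)
qed

text \<open>Inserting the unit before or after the balanced pair yields another balancing relation.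
  Only the insertion that separates the pair destroys the shape of the relation; there two relations
  are combined.\<close>

lemma amitsur_extend_balanced_rel:
  assumes gens: "us @ [b, c] @ vs \<in> gens n" and a: "a \<in> carrier A"
  shows "frag_extend (amitsur_pre B)
    (frag_of (us @ [b \<otimes>\<^bsub>B\<^esub> f a, c] @ vs) - frag_of (us @ [b, f a \<otimes>\<^bsub>B\<^esub> c] @ vs)) \<in> null (Suc n)"
proof -
  define g where "g k x y = frag_of (insert_nth k \<one>\<^bsub>B\<^esub> (us @ [x, y] @ vs))" for k x y
  have closed: "set us \<subseteq> carrier B" "set vs \<subseteq> carrier B" "b \<in> carrier B" "c \<in> carrier B"
    and n: "n = Suc (Suc (length us + length vs))"
    using gens by (auto simp: tensor_gens_def)
  have rel: "g k (b \<otimes>\<^bsub>B\<^esub> f a) c - g k b (f a \<otimes>\<^bsub>B\<^esub> c) \<in> null (Suc n)" for k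
  proof -
    consider "k \<le> length us" | "k = Suc (length us)" | "Suc (Suc (length us)) \<le> k"
      by linarith
    then show ?thesis
    proof cases
      case 1
      then have "g k x y = frag_of (insert_nth k \<one>\<^bsub>B\<^esub> us @ [x, y] @ vs)" for x y
        by (simp add: g_def insert_nth_append_left)
      then show ?thesis
        using closed a by (simp only:) (intro balanced_rel; simp add: n tensor_gens_def)
    next
      \<comment> \<open>With the unit between the two entries the scalar crosses in two moves:
        \<open>b f(a) \<otimes> 1 \<otimes> c\<close> equals
        \<open>b \<otimes> f(a) \<otimes> c\<close>, which equals
        \<open>b \<otimes> 1 \<otimes> f(a) c\<close>. The middle tensor appears because
        \<open>f(a) 1 = f(a) = 1 f(a)\<close>.\<close>
      case 2
      have g: "g k x y = frag_of (us @ [x, \<one>\<^bsub>B\<^esub>, y] @ vs)" for x y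
        using 2 by (simp add: g_def insert_nth_def)
      have "frag_of (us @ [b \<otimes>\<^bsub>B\<^esub> f a, \<one>\<^bsub>B\<^esub>] @ c # vs) - frag_of (us @ [b, f a \<otimes>\<^bsub>B\<^esub> \<one>\<^bsub>B\<^esub>] @ c # vs) \<in> null (Suc n)"
        using closed a by (intro balanced_rel) (auto simp: n tensor_gens_def)
      moreover have "frag_of ((us @ [b]) @ [\<one>\<^bsub>B\<^esub> \<otimes>\<^bsub>B\<^esub> f a, c] @ vs) -
          frag_of ((us @ [b]) @ [\<one>\<^bsub>B\<^esub>, f a \<otimes>\<^bsub>B\<^esub> c] @ vs) \<in> null (Suc n)"
        using closed a by (intro balanced_rel) (auto simp: n tensor_gens_def)
      ultimately have "g k (b \<otimes>\<^bsub>B\<^esub> f a) c - frag_of (us @ [b, f a, c] @ vs) +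
          (frag_of (us @ [b, f a, c] @ vs) - g k b (f a \<otimes>\<^bsub>B\<^esub> c)) \<in> null (Suc n)"
        using f_closed[OF a] by (intro tensor_null_add) (simp_all add: g)
      then show ?thesis
        by simp
    next
      case 3
      then have "g k x y = frag_of (us @ [x, y] @ insert_nth (k - Suc (Suc (length us))) \<one>\<^bsub>B\<^esub> vs)" for x y
        by (simp add: g_def insert_nth_append_right[of us] insert_nth_append_right[of "[x, y]", simplified])
      then show ?thesis
        using closed a by (simp only:) (intro balanced_rel; simp add: n tensor_gens_def)
    qed
  qed
  have "length (us @ [x, y] @ vs) = n" for x y
    by (simp add: n)
  then have "frag_extend (amitsur_pre B)
      (frag_of (us @ [b \<otimes>\<^bsub>B\<^esub> f a, c] @ vs) - frag_of (us @ [b, f a \<otimes>\<^bsub>B\<^esub> c] @ vs)) =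
    (\<Sum>k\<le>n. frag_cmul ((- 1) ^ k) (g k (b \<otimes>\<^bsub>B\<^esub> f a) c - g k b (f a \<otimes>\<^bsub>B\<^esub> c)))"
    by (simp only: frag_extend_diff frag_extend_of amitsur_pre_def insert_unit_eq g_def
        frag_cmul_diff_distrib2 sum_subtractf)
  with rel show ?thesis
    by (simp add: tensor_null_sum tensor_null_cmul)
qed

lemma amitsur_extend_null:
  assumes "c \<in> null n"
  shows "frag_extend (amitsur_pre B) c \<in> null (Suc n)"
proof -
  let ?E = "frag_extend (amitsur_pre B)"
  have rel: "?E h \<in> null (Suc n)" if "h \<in> tensor_rels A B f n" for h
    using that amitsur_extend_additive_rel amitsur_extend_balanced_rel
    unfolding tensor_rels_def by blast
  show ?thesis
    using assms unfolding tensor_null_def[of A B f n]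
  proof (induction c rule: generate.induct)
    case (inv h)
    \<comment> \<open>The inverse in \<open>free_Abelian_group\<close> simplifies to negation only
      for elements of its carrier.\<close>
    have "Poly_Mapping.keys h \<subseteq> gens n"
      using tensor_rels_subset inv by fastforce
    then show ?case
      using tensor_null_diff[OF tensor_null_zero rel[OF inv]] by (simp add: frag_extend_minus)
  qed (simp_all add: tensor_null_zero rel frag_extend_add tensor_null_add)
qed

text \<open>Well-definedness: \<open>the_elem\<close> in \<open>amitsur_diff\<close> has its
  intended value only if all representatives of a coset give the same class. Two representatives
  differ by a null element, which \<open>amitsur_extend_null\<close> sends to a null
  element.\<close>

lemma amitsur_diff_class:
  assumes "Poly_Mapping.keys c \<subseteq> gens (Suc n)"
  shows "amitsur_diff A B f n (cls (Suc n) c) = cls (Suc (Suc n)) (frag_extend (amitsur_pre B) c)"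
  unfolding amitsur_diff_def
proof (rule the_elem_image_unique)
  have coset: "cls (Suc n) c = (\<lambda>h. h + c) ` null (Suc n)"
    by (auto simp: tensor_class_def r_coset_def)
  then show "cls (Suc n) c \<noteq> {}"
    using tensor_null_zero by auto
  fix c' assume "c' \<in> cls (Suc n) c"
  then obtain h where h: "h \<in> null (Suc n)" and c': "c' = h + c"
    using coset by auto
  have "Poly_Mapping.keys h \<subseteq> gens (Suc n)"
    using subgroup.mem_carrier[OF subgroup_tensor_null h] by simp
  then have keys: "Poly_Mapping.keys c' \<subseteq> gens (Suc n)"
    using assms keys_add[of h c] by (auto simp: c')
  have extend_keys: "Poly_Mapping.keys (frag_extend (amitsur_pre B) d) \<subseteq> gens (Suc (Suc n))"
    if "Poly_Mapping.keys d \<subseteq> gens (Suc n)" for d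
    using hom_in_carrier[OF amitsur_extend_hom, of d "Suc n"] that by simp
  show "cls (Suc (Suc n)) (frag_extend (amitsur_pre B) c') = cls (Suc (Suc n)) (frag_extend (amitsur_pre B) c)"
    using amitsur_extend_null[OF h]
    by (intro tensor_class_eqI extend_keys keys assms) (simp add: c' frag_extend_add)
qed

lemma amitsur_diff_hom:
  "amitsur_diff A B f n \<in> hom (amitsur_group A B f n) (amitsur_group A B f (Suc n))"
proof -
  let ?E = "frag_extend (amitsur_pre B)"
  have E: "Poly_Mapping.keys (?E c) \<subseteq> gens (Suc (Suc n))" if "Poly_Mapping.keys c \<subseteq> gens (Suc n)" for c
    using hom_in_carrier[OF amitsur_extend_hom, of c "Suc n"] that by simp
  show ?thesis
    unfolding amitsur_group_def
  proof (rule homI)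
    fix S assume "S \<in> carrier (tens (Suc n))"
    then obtain c where c: "Poly_Mapping.keys c \<subseteq> gens (Suc n)" "S = cls (Suc n) c"
      by (rule tensor_power_cases)
    then show "amitsur_diff A B f n S \<in> carrier (tens (Suc (Suc n)))"
      using hom_in_carrier[OF tensor_class_hom, of "?E c"] E by (simp add: amitsur_diff_class)
    fix T assume "T \<in> carrier (tens (Suc n))"
    then obtain d where d: "Poly_Mapping.keys d \<subseteq> gens (Suc n)" "T = cls (Suc n) d"
      by (rule tensor_power_cases)
    have "Poly_Mapping.keys (c + d) \<subseteq> gens (Suc n)"
      using c d keys_add[of c d] by blast
    then have "amitsur_diff A B f n (cls (Suc n) (c + d)) = cls (Suc (Suc n)) (?E c + ?E d)"
      by (simp add: amitsur_diff_class frag_extend_add)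
    also have "\<dots> = amitsur_diff A B f n S \<otimes>\<^bsub>tens (Suc (Suc n))\<^esub> amitsur_diff A B f n T"
      using c d E by (simp add: amitsur_diff_class tensor_class_add)
    finally show "amitsur_diff A B f n (S \<otimes>\<^bsub>tens (Suc n)\<^esub> T) =
        amitsur_diff A B f n S \<otimes>\<^bsub>tens (Suc (Suc n))\<^esub> amitsur_diff A B f n T"
      using c d by (simp add: tensor_class_add)
  qed
qed

lemma cochain_complex_amitsur: "cochain_complex (amitsur_group A B f) (amitsur_diff A B f)"
  unfolding cochain_complex_def
proof (intro allI conjI ballI)
  let ?E = "frag_extend (amitsur_pre B)"
  fix n
  show "comm_group (amitsur_group A B f n)"
    by (simp add: amitsur_group_def comm_group_tensor_power)
  show "amitsur_diff A B f n \<in> hom (amitsur_group A B f n) (amitsur_group A B f (Suc n))"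
    by (rule amitsur_diff_hom)
  fix T assume "T \<in> carrier (amitsur_group A B f n)"
  then obtain c where c: "Poly_Mapping.keys c \<subseteq> gens (Suc n)" "T = cls (Suc n) c"
    unfolding amitsur_group_def by (rule tensor_power_cases)
  have Ec: "Poly_Mapping.keys (?E c) \<subseteq> gens (Suc (Suc n))"
    using hom_in_carrier[OF amitsur_extend_hom, of c "Suc n"] c by simp
  have "?E (?E c) = 0"
    using subset_UNIV
    by (induction c rule: frag_induction) (simp_all add: amitsur_pre_amitsur_pre frag_extend_diff)
  then show "amitsur_diff A B f (Suc n) (amitsur_diff A B f n T) = \<one>\<^bsub>amitsur_group A B f (Suc (Suc n))\<^esub>"
    using c Ec by (simp add: amitsur_diff_class amitsur_group_def tensor_class_null tensor_null_zero)
qed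

end

section \<open>Direct sums of rings\<close>

lemma direct_sum_ring_ops:
  "x \<otimes>\<^bsub>direct_sum_ring I R\<^esub> y = (\<lambda>i\<in>I. x i \<otimes>\<^bsub>R i\<^esub> y i)"
  "x \<oplus>\<^bsub>direct_sum_ring I R\<^esub> y = (\<lambda>i\<in>I. x i \<oplus>\<^bsub>R i\<^esub> y i)"
  "\<one>\<^bsub>direct_sum_ring I R\<^esub> = (\<lambda>i\<in>I. \<one>\<^bsub>R i\<^esub>)"
  "\<zero>\<^bsub>direct_sum_ring I R\<^esub> = (\<lambda>i\<in>I. \<zero>\<^bsub>R i\<^esub>)"
  by (simp_all add: direct_sum_ring_def)

lemma carrier_direct_sum_ring: "carrier (direct_sum_ring I R) = (\<Pi>\<^sub>E i\<in>I. carrier (R i))"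
  by (simp add: direct_sum_ring_def)

lemma direct_sum_ring_component:
  assumes "x \<in> carrier (direct_sum_ring I R)"
  shows "i \<in> I \<Longrightarrow> x i \<in> carrier (R i)" and "i \<notin> I \<Longrightarrow> x i = undefined"
  using assms by (auto simp: carrier_direct_sum_ring)

lemma ring_direct_sum_ring:
  assumes "\<And>i. i \<in> I \<Longrightarrow> ring (R i)"
  shows "ring (direct_sum_ring I R)"
proof -
  note simps = direct_sum_ring_ops carrier_direct_sum_ring PiE_iff extensional_def fun_eq_iff
    ring.ring_simprules(1-3,5-9,11-13,23)[OF assms] monoid.r_one[OF ring.is_monoid[OF assms]]
  show ?thesis
  proof (rule ringI)
    show "abelian_group (direct_sum_ring I R)"
    proof (rule abelian_groupI)
      fix x assume x: "x \<in> carrier (direct_sum_ring I R)"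
      have "(\<lambda>i\<in>I. \<ominus>\<^bsub>R i\<^esub> x i) \<oplus>\<^bsub>direct_sum_ring I R\<^esub> x = \<zero>\<^bsub>direct_sum_ring I R\<^esub>"
        using x by (simp add: simps)
      moreover have "(\<lambda>i\<in>I. \<ominus>\<^bsub>R i\<^esub> x i) \<in> carrier (direct_sum_ring I R)"
        using x by (simp add: simps)
      ultimately show "\<exists>y\<in>carrier (direct_sum_ring I R). y \<oplus>\<^bsub>direct_sum_ring I R\<^esub> x = \<zero>\<^bsub>direct_sum_ring I R\<^esub>"
        by (rule bexI)
    next
      fix x y assume x: "x \<in> carrier (direct_sum_ring I R)" and y: "y \<in> carrier (direct_sum_ring I R)"
      show "x \<oplus>\<^bsub>direct_sum_ring I R\<^esub> y = y \<oplus>\<^bsub>direct_sum_ring I R\<^esub> x"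
        unfolding direct_sum_ring_ops
        by (rule restrict_ext)
          (rule ring.ring_simprules(10)[OF assms direct_sum_ring_component(1)[OF x] direct_sum_ring_component(1)[OF y]])
    qed (simp_all add: simps)
    show "monoid (direct_sum_ring I R)"
      by (rule monoidI) (simp_all add: simps)
  qed (simp_all add: simps)
qed

lemma summand_in_carrier:
  assumes "\<And>i. i \<in> I \<Longrightarrow> ring (R i)" "i \<in> I" "y \<in> carrier (R i)"
  shows "summand I R i y \<in> carrier (direct_sum_ring I R)"
  using assms by (auto simp: summand_def direct_sum_ring_def ring.ring_simprules)

text \<open>Induction over the set of coordinates kept: \<open>part S\<close> is the truncation of
  \<open>x\<close> to \<open>S\<close>, and each new coordinate contributes one summand. The target
  is a multiplicatively written commutative group, so that both \<open>functor_group\<close> and the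
  additive group of a ring can be substituted.\<close>

lemma hom_direct_sum_eq_finprod:
  assumes "finite I" and R: "\<And>i. i \<in> I \<Longrightarrow> ring (R i)" and "comm_group H"
    and F: "F \<in> hom (add_monoid (direct_sum_ring I R)) H"
    and x: "x \<in> carrier (direct_sum_ring I R)"
  shows "F x = finprod H (\<lambda>i. F (summand I R i (x i))) I"
proof -
  interpret H: comm_group H by fact
  interpret D: ring "direct_sum_ring I R"
    using R by (rule ring_direct_sum_ring)
  have xi: "x i \<in> carrier (R i)" if "i \<in> I" for i
    using x that by (auto simp: direct_sum_ring_def)
  have F_closed: "F y \<in> carrier H" if "y \<in> carrier (direct_sum_ring I R)" for y
    using hom_in_carrier[OF F, of y] that by simp
  define part where "part S = (\<lambda>i\<in>I. if i \<in> S then x i else \<zero>\<^bsub>R i\<^esub>)" for S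
  have part_closed: "part S \<in> carrier (direct_sum_ring I R)" for S
    using xi R by (auto simp: part_def direct_sum_ring_def ring.ring_simprules)
  have F_part: "F (part S) = finprod H (\<lambda>i. F (summand I R i (x i))) S" if "S \<subseteq> I" for S
    using finite_subset[OF that \<open>finite I\<close>] that
  proof (induction S rule: finite_induct)
    case empty
    have "part {} = \<zero>\<^bsub>direct_sum_ring I R\<^esub>"
      by (auto simp: part_def direct_sum_ring_def)
    then show ?case
      using hom_one[OF F D.a_group H.group_axioms] by simp
  next
    case (insert i S)
    have "part (insert i S) = summand I R i (x i) \<oplus>\<^bsub>direct_sum_ring I R\<^esub> part S"
      using insert xi R by (auto simp: part_def summand_def direct_sum_ring_def ring.ring_simprules
          intro!: restrict_ext)
    then have "F (part (insert i S)) = F (summand I R i (x i)) \<otimes>\<^bsub>H\<^esub> F (part S)"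
      using hom_mult[OF F, of "summand I R i (x i)" "part S"] part_closed xi insert.prems R
      by (simp add: summand_in_carrier)
    also have "\<dots> = finprod H (\<lambda>i. F (summand I R i (x i))) (insert i S)"
      using insert xi R by (subst H.finprod_insert) (auto intro!: F_closed summand_in_carrier)
    finally show ?case .
  qed
  have "part I = x"
    using direct_sum_ring_component[OF x] by (auto simp: part_def)
  with F_part[OF subset_refl] show ?thesis
    by simp
qed


section \<open>The comparison map\<close>

lemma foldr_mult_closed:
  assumes "ring R" "set xs \<subseteq> carrier R"
  shows "foldr (\<otimes>\<^bsub>R\<^esub>) xs \<one>\<^bsub>R\<^esub> \<in> carrier R"
  using assms by (induction xs) (auto simp: ring.ring_simprules)

lemma foldr_mult_insert_one:
  assumes "ring R" "set xs \<subseteq> carrier R"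
  shows "foldr (\<otimes>\<^bsub>R\<^esub>) (insert_nth k \<one>\<^bsub>R\<^esub> xs) \<one>\<^bsub>R\<^esub> = foldr (\<otimes>\<^bsub>R\<^esub>) xs \<one>\<^bsub>R\<^esub>"
proof -
  have "set (drop k xs) \<subseteq> carrier R"
    using assms(2) set_drop_subset[of k xs] by blast
  then have "foldr (\<otimes>\<^bsub>R\<^esub>) (insert_nth k \<one>\<^bsub>R\<^esub> xs) \<one>\<^bsub>R\<^esub> = foldr (\<otimes>\<^bsub>R\<^esub>) (take k xs @ drop k xs) \<one>\<^bsub>R\<^esub>"
    using assms(1) foldr_mult_closed[OF assms(1), of "drop k xs"]
    by (simp only: insert_nth_def foldr_append foldr.simps o_def ring.ring_simprules)
  then show ?thesis
    by simp
qed

lemma ring_hom_foldr_mult: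
  assumes "ring R" "h \<in> ring_hom R S" "set xs \<subseteq> carrier R"
  shows "h (foldr (\<otimes>\<^bsub>R\<^esub>) xs \<one>\<^bsub>R\<^esub>) = foldr (\<otimes>\<^bsub>S\<^esub>) (map h xs) \<one>\<^bsub>S\<^esub>"
  using assms(3)
proof (induction xs)
  case Nil
  then show ?case
    using ring_hom_one[OF assms(2)] by simp
next
  case (Cons x xs)
  then show ?case
    using ring_hom_mult[OF assms(2), of x] foldr_mult_closed[OF assms(1)] by simp
qed

text \<open>The coface of a value of \<open>\<phi>\<close> is the value for the longer index list.
  The structure map is multiplicative, functoriality contracts each passage from \<open>[j]\<close>
  through \<open>\<zeta>\<close> to one direct map, and the extra factor is 1 since
  \<open>\<Phi> i\<close> and the structure map out of \<open>R [i]\<close> preserve units.\<close>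

lemma (in functor_complex) r_phi_value:
  assumes \<Phi>: "\<And>i. i \<in> I \<Longrightarrow> \<Phi> i \<in> ring_hom (Q i) (R [i])"
    and \<eta>: "insert_nth k i \<zeta> \<in> ordered_subsets I" and k: "k \<le> length \<zeta>"
    and len: "length ys = length \<zeta>"
    and ys: "\<And>j. j < length \<zeta> \<Longrightarrow> ys ! j \<in> carrier (Q (\<zeta> ! j))"
  shows "r \<zeta> (insert_nth k i \<zeta>) (phi_value R r \<Phi> \<zeta> ys) =
    phi_value R r \<Phi> (insert_nth k i \<zeta>) (insert_nth k \<one>\<^bsub>Q i\<^esub> ys)"
proof -
  let ?\<eta> = "insert_nth k i \<zeta>"
  have del: "delete_nth k ?\<eta> = \<zeta>"
    using insert_nth_eq_iff[of k ?\<eta> i \<zeta>] k by simp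
  have lev: "?\<eta> \<in> level I (Suc (length \<zeta>))"
    using \<eta> by (simp add: level_def)
  have \<zeta>: "\<zeta> \<in> ordered_subsets I"
    using delete_nth_in_level[OF lev k] by (simp add: del level_def)
  have r: "r \<zeta> ?\<eta> \<in> ring_hom (R \<zeta>) (R ?\<eta>)"
    using hom_r_delete_nth[OF lev k] by (simp add: del)
  have sub: "subseq \<zeta> ?\<eta>"
    using subseq_delete_nth[of k ?\<eta>] by (simp add: del)
  have single: "[j] \<in> ordered_subsets I" "subseq [j] \<theta>"
    if "j \<in> set \<theta>" "\<theta> \<in> ordered_subsets I" for j \<theta>
    using that by (auto simp: ordered_subsets_def subseq_singleton_left)
  have \<Phi>_closed: "\<Phi> j y \<in> carrier (R [j])" if "(j, y) \<in> set (zip \<zeta> ys)" for j y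
  proof -
    from that obtain m where m: "m < length \<zeta>" "j = \<zeta> ! m" "y = ys ! m"
      by (auto simp: set_zip)
    have "set \<zeta> \<subseteq> I"
      using \<zeta> by (simp add: ordered_subsets_def)
    then have "j \<in> I"
      using m nth_mem[of m \<zeta>] by blast
    then show ?thesis
      using ys[OF m(1)] m ring_hom_closed[OF \<Phi>] by simp
  qed
  have closed: "r [j] \<theta> (\<Phi> j y) \<in> carrier (R \<theta>)"
    if "(j, y) \<in> set (zip \<zeta> ys)" "set \<zeta> \<subseteq> set \<theta>" "\<theta> \<in> ordered_subsets I" for j y \<theta>
  proof -
    have "j \<in> set \<theta>"
      using set_zip_leftD[OF that(1)] that(2) by blast
    then show ?thesis
      using that by (intro ring_hom_closed[OF hom_r \<Phi>_closed] single) simp_all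
  qed
  have "r \<zeta> ?\<eta> (phi_value R r \<Phi> \<zeta> ys) =
      foldr (\<otimes>\<^bsub>R ?\<eta>\<^esub>) (map (r \<zeta> ?\<eta>) (map2 (\<lambda>j y. r [j] \<zeta> (\<Phi> j y)) \<zeta> ys)) \<one>\<^bsub>R ?\<eta>\<^esub>"
    unfolding phi_value_def using \<zeta> closed[of _ _ \<zeta>]
    by (intro ring_hom_foldr_mult[OF ring_R r]) auto
  also have "map (r \<zeta> ?\<eta>) (map2 (\<lambda>j y. r [j] \<zeta> (\<Phi> j y)) \<zeta> ys) = map2 (\<lambda>j y. r [j] ?\<eta> (\<Phi> j y)) \<zeta> ys"
  proof -
    have "r \<zeta> ?\<eta> (r [j] \<zeta> (\<Phi> j y)) = r [j] ?\<eta> (\<Phi> j y)" if "(j, y) \<in> set (zip \<zeta> ys)" for j y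
      using single[OF set_zip_leftD[OF that] \<zeta>] \<zeta> \<eta> sub \<Phi>_closed[OF that] by (intro r_comp)
    then show ?thesis
      by (auto simp: case_prod_beta)
  qed
  also have "foldr (\<otimes>\<^bsub>R ?\<eta>\<^esub>) (map2 (\<lambda>j y. r [j] ?\<eta> (\<Phi> j y)) \<zeta> ys) \<one>\<^bsub>R ?\<eta>\<^esub> =
      foldr (\<otimes>\<^bsub>R ?\<eta>\<^esub>) (insert_nth k \<one>\<^bsub>R ?\<eta>\<^esub> (map2 (\<lambda>j y. r [j] ?\<eta> (\<Phi> j y)) \<zeta> ys)) \<one>\<^bsub>R ?\<eta>\<^esub>"
    using \<eta> closed[of _ _ ?\<eta>] by (intro foldr_mult_insert_one[symmetric] ring_R) auto
  also have "insert_nth k \<one>\<^bsub>R ?\<eta>\<^esub> (map2 (\<lambda>j y. r [j] ?\<eta> (\<Phi> j y)) \<zeta> ys) =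
      map2 (\<lambda>j y. r [j] ?\<eta> (\<Phi> j y)) ?\<eta> (insert_nth k \<one>\<^bsub>Q i\<^esub> ys)"
  proof -
    have i: "i \<in> set ?\<eta>" "i \<in> I"
      using \<eta> by (auto simp: ordered_subsets_def)
    then have "r [i] ?\<eta> (\<Phi> i \<one>\<^bsub>Q i\<^esub>) = \<one>\<^bsub>R ?\<eta>\<^esub>"
      using ring_hom_one[OF \<Phi>[OF i(2)]] ring_hom_one[OF hom_r[OF single(1)[OF i(1) \<eta>] \<eta> single(2)[OF i(1) \<eta>]]]
      by simp
    then show ?thesis
      using len by (simp add: map2_insert_nth)
  qed
  finally show ?thesis
    by (simp only: phi_value_def)
qed

lemma map2_summand_in_carrier:
  assumes "\<And>i. i \<in> I \<Longrightarrow> ring (Q i)" "length \<zeta> = length ys" "set \<zeta> \<subseteq> I"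
    and "\<forall>k<length \<zeta>. ys ! k \<in> carrier (Q (\<zeta> ! k))"
  shows "set (map2 (summand I Q) \<zeta> ys) \<subseteq> carrier (direct_sum_ring I Q)"
proof
  fix v assume "v \<in> set (map2 (summand I Q) \<zeta> ys)"
  then obtain m where m: "m < length \<zeta>" "v = summand I Q (\<zeta> ! m) (ys ! m)"
    using assms(2) by (auto simp: set_zip)
  moreover have "\<zeta> ! m \<in> I"
    using m nth_mem assms(3) by blast
  ultimately show "v \<in> carrier (direct_sum_ring I Q)"
    using assms(1,4) by (simp add: summand_in_carrier)
qed

text \<open>The values of \<open>\<phi>\<close> are prescribed only when every entry lies in a
  single summand. Such tensors generate the tensor power, because each entry of a pure tensor is the
  sum of its components and tensors are additive in every slot.\<close>

lemma hom_eq_on_summand_tensors: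
  assumes ext: "ring_extension A (direct_sum_ring I Q) f"
    and I: "finite I" and Q: "\<And>i. i \<in> I \<Longrightarrow> ring (Q i)" and H: "comm_group H"
    and F: "F \<in> hom (tensor_power A (direct_sum_ring I Q) f n) H"
    and G: "G \<in> hom (tensor_power A (direct_sum_ring I Q) f n) H"
    and eq: "\<And>\<zeta> ys. \<lbrakk>length \<zeta> = n; set \<zeta> \<subseteq> I; length ys = n; \<forall>k<n. ys ! k \<in> carrier (Q (\<zeta> ! k))\<rbrakk> \<Longrightarrow>
      F (pure_tensor A (direct_sum_ring I Q) f (map2 (summand I Q) \<zeta> ys)) =
      G (pure_tensor A (direct_sum_ring I Q) f (map2 (summand I Q) \<zeta> ys))"
    and T: "T \<in> carrier (tensor_power A (direct_sum_ring I Q) f n)"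
  shows "F T = G T"
proof -
  let ?B = "direct_sum_ring I Q"
  interpret ring_extension A ?B f
    by (rule ext)
  interpret H: comm_group H
    by (rule H)
  \<comment> \<open>Interpolates between general and homogeneous tensors: \<open>us\<close> is
    arbitrary, the tail consists of elements of summands. Reverse induction splits the last entry of
    \<open>us\<close> and moves each component to the front of the tail, hence
    \<open>\<zeta>\<close> and \<open>ys\<close> must vary. The hypothesis is the case of empty
    \<open>us\<close>, the goal that of an empty tail.\<close>
  have mixed: "F (pure_tensor A ?B f (us @ map2 (summand I Q) \<zeta> ys)) =
      G (pure_tensor A ?B f (us @ map2 (summand I Q) \<zeta> ys))"
    if "length us + length \<zeta> = n" "set us \<subseteq> carrier ?B" "set \<zeta> \<subseteq> I" "length ys = length \<zeta>"
      "\<forall>k<length \<zeta>. ys ! k \<in> carrier (Q (\<zeta> ! k))" for us \<zeta> ys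
    using that
  proof (induction us arbitrary: \<zeta> ys rule: rev_induct)
    case Nil
    then show ?case
      using eq by simp
  next
    case (snoc x us)
    let ?vs = "map2 (summand I Q) \<zeta> ys"
    have x: "x \<in> carrier ?B" and us: "set us \<subseteq> carrier ?B"
      using snoc.prems by auto
    have vs: "set ?vs \<subseteq> carrier ?B"
      using Q snoc.prems by (intro map2_summand_in_carrier) auto
    have len: "length us + Suc (length ?vs) = n"
      using snoc.prems by simp
    define p where "p = (\<lambda>b. pure_tensor A ?B f (us @ b # ?vs))"
    have p: "p \<in> hom (add_monoid ?B) (tensor_power A ?B f n)"
      unfolding p_def by (rule pure_tensor_hom[OF us vs len])
    have step: "F (p (summand I Q i (x i))) = G (p (summand I Q i (x i)))" if "i \<in> I" for i
    proof -
      have "\<forall>k<length (i # \<zeta>). (x i # ys) ! k \<in> carrier (Q ((i # \<zeta>) ! k))"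
        using snoc.prems(5) direct_sum_ring_component(1)[OF x that] by (auto simp: nth_Cons split: nat.split)
      then have "F (pure_tensor A ?B f (us @ map2 (summand I Q) (i # \<zeta>) (x i # ys))) =
          G (pure_tensor A ?B f (us @ map2 (summand I Q) (i # \<zeta>) (x i # ys)))"
        using snoc.prems that us by (intro snoc.IH) auto
      then show ?thesis
        by (simp add: p_def)
    qed
    have "(F \<circ> p) x = finprod H (\<lambda>i. (F \<circ> p) (summand I Q i (x i))) I"
      by (rule hom_direct_sum_eq_finprod[OF I Q H hom_compose[OF p F] x])
    also have "\<dots> = finprod H (\<lambda>i. (G \<circ> p) (summand I Q i (x i))) I"
    proof (rule H.finprod_cong')
      have "summand I Q i (x i) \<in> carrier (add_monoid ?B)" if "i \<in> I" for i
        using Q that direct_sum_ring_component(1)[OF x that] by (simp add: summand_in_carrier)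
      then show "(\<lambda>i. (G \<circ> p) (summand I Q i (x i))) \<in> I \<rightarrow> carrier H"
        using hom_in_carrier[OF hom_compose[OF p G]] by blast
    qed (simp_all add: step)
    also have "\<dots> = (G \<circ> p) x"
      by (rule hom_direct_sum_eq_finprod[OF I Q H hom_compose[OF p G] x, symmetric])
    finally show ?case
      by (simp add: p_def)
  qed
  show ?thesis
  proof (rule hom_eq_on_tensor_power[OF H.is_group F G _ T])
    show "F (pure_tensor A ?B f xs) = G (pure_tensor A ?B f xs)" if "xs \<in> tensor_gens ?B n" for xs
      using mixed[of xs "[]" "[]"] that by (simp add: tensor_gens_def)
  qed
qed

text \<open>Rings \<open>Q i\<close> stand in for the quotients \<open>A/I_i\<close>, which keeps
  cosets out of the computation; \<open>f\<close> stands for the map from \<open>A\<close> into the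
  direct sum.\<close>

locale comparison = functor_complex I R r + ring_extension A "direct_sum_ring I Q" f
  for I :: "'i set" and R :: "'i list \<Rightarrow> ('r, 'm) ring_scheme" and r :: "'i list \<Rightarrow> 'i list \<Rightarrow> 'r \<Rightarrow> 'r"
    and A :: "('a, 'c) ring_scheme" and Q :: "'i \<Rightarrow> ('q, 'e) ring_scheme" and f :: "'a \<Rightarrow> 'i \<Rightarrow> 'q" +
  fixes \<Phi> :: "'i \<Rightarrow> 'q \<Rightarrow> 'r" and \<phi> :: "nat \<Rightarrow> (('i \<Rightarrow> 'q) list \<Rightarrow>\<^sub>0 int) set \<Rightarrow> 'i list \<Rightarrow> 'r"
  assumes ring_Q: "i \<in> I \<Longrightarrow> ring (Q i)"
    and hom_\<Phi>: "i \<in> I \<Longrightarrow> \<Phi> i \<in> ring_hom (Q i) (R [i])"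
    and hom_\<phi>: "\<phi> n \<in> hom (amitsur_group A (direct_sum_ring I Q) f n) (functor_group I R (Suc n))"
    and \<phi>_pure: "\<lbrakk>length \<zeta> = Suc n; set \<zeta> \<subseteq> I; length ys = Suc n; \<forall>k\<le>n. ys ! k \<in> carrier (Q (\<zeta> ! k))\<rbrakk> \<Longrightarrow>
      \<phi> n (pure_tensor A (direct_sum_ring I Q) f (map2 (summand I Q) \<zeta> ys)) =
        (if \<zeta> \<in> ordered_subsets I then summand (level I (Suc n)) R \<zeta> (phi_value R r \<Phi> \<zeta> ys)
         else \<one>\<^bsub>functor_group I R (Suc n)\<^esub>)"
begin

abbreviation "B \<equiv> direct_sum_ring I Q"
abbreviation "tensor_of \<equiv> map2 (summand I Q)"

text \<open>Merges both clauses of the definition of \<open>\<phi>\<close>: a \<open>\<zeta>\<close>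
  with a repeated index never equals an \<open>\<eta>\<close> from the level, so its components
  vanish by the same case distinction.\<close>

lemma \<phi>_pure_component:
  assumes "length \<zeta> = Suc n" "set \<zeta> \<subseteq> I" "length ys = Suc n" "\<forall>k\<le>n. ys ! k \<in> carrier (Q (\<zeta> ! k))"
    and "\<eta> \<in> level I (Suc n)"
  shows "\<phi> n (pure_tensor A B f (tensor_of \<zeta> ys)) \<eta> = (if \<eta> = \<zeta> then phi_value R r \<Phi> \<eta> ys else \<zero>\<^bsub>R \<eta>\<^esub>)"
  unfolding \<phi>_pure[OF assms(1-4)] one_functor_group
  using assms(5) by (auto simp: summand_def level_def)

lemma \<phi>_component_hom:
  assumes "\<eta> \<in> level I (Suc n)"
  shows "(\<lambda>T. \<phi> n T \<eta>) \<in> hom (tens (Suc n)) (add_monoid (R \<eta>))"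
  using hom_compose[OF hom_\<phi>[unfolded amitsur_group_def] component_hom[OF assms]] by (simp add: o_def)

text \<open>Writing \<open>1 = \<Sum>\<^sub>i 1\<^sub>i\<close> in the inserted entry, only the index \<open>i = \<eta> ! k\<close> can
  contribute to the \<open>\<eta>\<close>-component.\<close>

lemma \<phi>_insert_unit:
  assumes \<zeta>: "length \<zeta> = Suc n" "set \<zeta> \<subseteq> I" and ys: "length ys = Suc n" "\<forall>k\<le>n. ys ! k \<in> carrier (Q (\<zeta> ! k))"
    and \<eta>: "\<eta> \<in> level I (Suc (Suc n))" and k: "k \<le> Suc n"
  shows "\<phi> (Suc n) (pure_tensor A B f (insert_nth k \<one>\<^bsub>B\<^esub> (tensor_of \<zeta> ys))) \<eta> =
    r (delete_nth k \<eta>) \<eta> (\<phi> n (pure_tensor A B f (tensor_of \<zeta> ys)) (delete_nth k \<eta>))"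
proof -
  have ring_\<eta>: "ring (R \<eta>)"
    using \<eta> by (rule ring_level)
  interpret R: ring "R \<eta>"
    by (rule ring_\<eta>)
  have len: "length \<eta> = Suc (Suc n)" and "set \<eta> \<subseteq> I" and ord: "\<eta> \<in> ordered_subsets I"
    using \<eta> by (auto simp: level_def ordered_subsets_def)
  have i0: "\<eta> ! k \<in> I"
    using \<open>set \<eta> \<subseteq> I\<close> nth_mem[of k \<eta>] k len by auto
  let ?xs = "tensor_of \<zeta> ys" and ?d = "delete_nth k \<eta>"
  have xs: "set ?xs \<subseteq> carrier B" "length ?xs = Suc n"
    using map2_summand_in_carrier[of I Q \<zeta> ys] ring_Q \<zeta> ys by (auto simp: less_Suc_eq_le)
  \<comment> \<open>With entry \<open>k\<close> as a variable this is an additive map on the direct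
    sum, so its value at the unit is the sum of its values at the units of the summands.\<close>
  define h where "h = (\<lambda>b. \<phi> (Suc n) (pure_tensor A B f (insert_nth k b ?xs)) \<eta>)"
  have "set (take k ?xs) \<subseteq> carrier B" "set (drop k ?xs) \<subseteq> carrier B"
    using xs(1) set_take_subset[of k ?xs] set_drop_subset[of k ?xs] by blast+
  moreover have "length (take k ?xs) + Suc (length (drop k ?xs)) = Suc (Suc n)"
    using xs(2) k by simp
  ultimately have "(\<lambda>b. pure_tensor A B f (take k ?xs @ b # drop k ?xs)) \<in> hom (add_monoid B) (tens (Suc (Suc n)))"
    by (rule pure_tensor_hom)
  then have h: "h \<in> hom (add_monoid B) (add_monoid (R \<eta>))"
    unfolding h_def insert_nth_def using \<phi>_component_hom[OF \<eta>] by (rule hom_compose[unfolded o_def])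
  have face: "insert_nth k i \<zeta> = \<eta> \<longleftrightarrow> i = \<eta> ! k \<and> ?d = \<zeta>" for i
    using insert_nth_eq_iff[of k \<eta> i \<zeta>] k len \<zeta>(1) by auto
  have h_summand: "h (summand I Q i \<one>\<^bsub>Q i\<^esub>) =
      (if insert_nth k i \<zeta> = \<eta> then phi_value R r \<Phi> \<eta> (insert_nth k \<one>\<^bsub>Q i\<^esub> ys) else \<zero>\<^bsub>R \<eta>\<^esub>)" if i: "i \<in> I" for i
  proof -
    have "\<forall>j\<le>Suc n. insert_nth k \<one>\<^bsub>Q i\<^esub> ys ! j \<in> carrier (Q (insert_nth k i \<zeta> ! j))"
    proof (intro allI impI)
      fix j assume "j \<le> Suc n"
      then show "insert_nth k \<one>\<^bsub>Q i\<^esub> ys ! j \<in> carrier (Q (insert_nth k i \<zeta> ! j))"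
        using ys \<zeta> k ring.ring_simprules(6)[OF ring_Q[OF i]] by (auto simp: nth_insert_nth)
    qed
    then have "\<phi> (Suc n) (pure_tensor A B f (tensor_of (insert_nth k i \<zeta>) (insert_nth k \<one>\<^bsub>Q i\<^esub> ys))) \<eta> =
        (if \<eta> = insert_nth k i \<zeta> then phi_value R r \<Phi> \<eta> (insert_nth k \<one>\<^bsub>Q i\<^esub> ys) else \<zero>\<^bsub>R \<eta>\<^esub>)"
      using \<zeta> ys i \<eta> by (intro \<phi>_pure_component) auto
    then show ?thesis
      using \<zeta>(1) ys(1) by (auto simp: h_def map2_insert_nth)
  qed
  have one: "\<one>\<^bsub>B\<^esub> \<in> carrier B"
    by (rule B.one_closed)
  have summand_closed: "h (summand I Q i \<one>\<^bsub>Q i\<^esub>) \<in> carrier (R \<eta>)" if "i \<in> I" for i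
    using hom_in_carrier[OF h, of "summand I Q i \<one>\<^bsub>Q i\<^esub>"] ring_Q that
    by (simp add: summand_in_carrier ring.ring_simprules(6))
  have "h \<one>\<^bsub>B\<^esub> = (\<Oplus>\<^bsub>R \<eta>\<^esub>i\<in>I. h (summand I Q i (\<one>\<^bsub>B\<^esub> i)))"
    unfolding finsum_def by (rule hom_direct_sum_eq_finprod[OF finite_index ring_Q R.a_comm_group h one])
  also have "\<dots> = (\<Oplus>\<^bsub>R \<eta>\<^esub>i\<in>I. if \<eta> ! k = i then h (summand I Q i \<one>\<^bsub>Q i\<^esub>) else \<zero>\<^bsub>R \<eta>\<^esub>)"
  proof (rule R.finsum_cong'[OF refl])
    show "h (summand I Q i (\<one>\<^bsub>B\<^esub> i)) = (if \<eta> ! k = i then h (summand I Q i \<one>\<^bsub>Q i\<^esub>) else \<zero>\<^bsub>R \<eta>\<^esub>)"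
      if "i \<in> I" for i
      using that by (simp add: direct_sum_ring_ops h_summand face)
  qed (use summand_closed in auto)
  also have "\<dots> = h (summand I Q (\<eta> ! k) \<one>\<^bsub>Q (\<eta> ! k)\<^esub>)"
    using summand_closed by (intro R.finsum_singleton[OF i0 finite_index]) auto
  also have "\<dots> = (if ?d = \<zeta> then phi_value R r \<Phi> \<eta> (insert_nth k \<one>\<^bsub>Q (\<eta> ! k)\<^esub> ys) else \<zero>\<^bsub>R \<eta>\<^esub>)"
    by (simp add: h_summand[OF i0] face)
  \<comment> \<open>If deleting position \<open>k\<close> of \<open>\<eta>\<close> does not give
    \<open>\<zeta>\<close>, both sides are zero; otherwise this is \<open>r_phi_value\<close> for
    the index \<open>\<eta> ! k\<close>.\<close>
  also have "\<dots> = r ?d \<eta> (if ?d = \<zeta> then phi_value R r \<Phi> ?d ys else \<zero>\<^bsub>R ?d\<^esub>)"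
  proof (cases "?d = \<zeta>")
    case True
    then have ins: "insert_nth k (\<eta> ! k) \<zeta> = \<eta>"
      by (simp add: face)
    have "r \<zeta> (insert_nth k (\<eta> ! k) \<zeta>) (phi_value R r \<Phi> \<zeta> ys) =
        phi_value R r \<Phi> (insert_nth k (\<eta> ! k) \<zeta>) (insert_nth k \<one>\<^bsub>Q (\<eta> ! k)\<^esub> ys)"
      using ord k \<zeta>(1) ys by (intro r_phi_value[OF hom_\<Phi>]) (auto simp: ins less_Suc_eq_le)
    with True show ?thesis
      by (simp add: ins)
  next
    case False
    have "?d \<in> level I (Suc n)"
      using \<eta> k by (rule delete_nth_in_level)
    then show ?thesis
      using False ring_hom_zero[OF hom_r_delete_nth[OF \<eta> k] ring_level ring_\<eta>] by simp
  qed
  also have "\<dots> = r ?d \<eta> (\<phi> n (pure_tensor A B f ?xs) ?d)"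
    using \<phi>_pure_component[OF \<zeta> ys delete_nth_in_level[OF \<eta> k]] by simp
  finally show ?thesis
    by (simp add: h_def)
qed

text \<open>No cancellation occurs: inserting the unit at position \<open>k\<close> of the tensor is
  dual to deleting position \<open>k\<close> of \<open>\<eta>\<close>. Both differentials thus run
  over the same \<open>k\<close> with the same sign, and the terms agree one by one by
  \<open>\<phi>_insert_unit\<close>.\<close>

lemma \<phi>_diff_pure:
  assumes \<zeta>: "length \<zeta> = Suc n" "set \<zeta> \<subseteq> I" and ys: "length ys = Suc n" "\<forall>k\<le>n. ys ! k \<in> carrier (Q (\<zeta> ! k))"
  shows "\<phi> (Suc n) (amitsur_diff A B f n (pure_tensor A B f (tensor_of \<zeta> ys))) =
    functor_diff I R r (Suc n) (\<phi> n (pure_tensor A B f (tensor_of \<zeta> ys)))"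
proof (rule PiE_ext)
  let ?xs = "tensor_of \<zeta> ys"
  have xs: "?xs \<in> tensor_gens B (Suc n)"
    using map2_summand_in_carrier[of I Q \<zeta> ys] ring_Q \<zeta> ys by (auto simp: tensor_gens_def less_Suc_eq_le)
  have pure: "pure_tensor A B f ?xs \<in> carrier (amitsur_group A B f n)"
    unfolding amitsur_group_def using xs by (rule pure_tensor_in_carrier)
  show "\<phi> (Suc n) (amitsur_diff A B f n (pure_tensor A B f ?xs)) \<in> (\<Pi>\<^sub>E \<eta>\<in>level I (Suc (Suc n)). carrier (R \<eta>))"
    using hom_in_carrier[OF hom_\<phi> hom_in_carrier[OF amitsur_diff_hom pure]] by (simp add: carrier_functor_group)
  have \<phi>xs: "\<phi> n (pure_tensor A B f ?xs) \<in> carrier (functor_group I R (Suc n))"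
    by (rule hom_in_carrier[OF hom_\<phi> pure])
  show "functor_diff I R r (Suc n) (\<phi> n (pure_tensor A B f ?xs)) \<in> (\<Pi>\<^sub>E \<eta>\<in>level I (Suc (Suc n)). carrier (R \<eta>))"
    using hom_in_carrier[OF functor_diff_hom \<phi>xs] by (simp add: carrier_functor_group)
  fix \<eta> assume \<eta>: "\<eta> \<in> level I (Suc (Suc n))"
  interpret R: ring "R \<eta>"
    using \<eta> by (rule ring_level)
  have len: "length ?xs = Suc n"
    using \<zeta> ys by simp
  have ins: "insert_nth k \<one>\<^bsub>B\<^esub> ?xs \<in> tensor_gens B (Suc (Suc n))" for k
    using xs by (auto simp: tensor_gens_def)
  \<comment> \<open>Reads the \<open>\<eta>\<close>-component of \<open>\<phi>\<close> off a
    representative. As a homomorphism on the free group, it turns the formal sum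
    \<open>amitsur_pre\<close> into a \<open>finsum\<close> in \<open>R \<eta>\<close>.\<close>
  define F where "F = (\<lambda>c. \<phi> (Suc n) (cls (Suc (Suc n)) c) \<eta>)"
  have F: "F \<in> hom (free_Abelian_group (tensor_gens B (Suc (Suc n)))) (add_monoid (R \<eta>))"
    using hom_compose[OF tensor_class_hom \<phi>_component_hom[OF \<eta>]] by (simp add: F_def o_def)
  have F_of: "F (frag_of (insert_nth k \<one>\<^bsub>B\<^esub> ?xs)) = \<phi> (Suc n) (pure_tensor A B f (insert_nth k \<one>\<^bsub>B\<^esub> ?xs)) \<eta>" for k
    using len by (simp add: F_def pure_tensor_def)
  have F_closed: "F (frag_of (insert_nth k \<one>\<^bsub>B\<^esub> ?xs)) \<in> carrier (R \<eta>)" for k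
    using hom_in_carrier[OF F, of "frag_of (insert_nth k \<one>\<^bsub>B\<^esub> ?xs)"] ins by simp
  have "amitsur_diff A B f n (pure_tensor A B f ?xs) = cls (Suc (Suc n)) (amitsur_pre B ?xs)"
    using amitsur_diff_class[of "frag_of ?xs" n] xs len by (simp add: pure_tensor_def)
  then have "\<phi> (Suc n) (amitsur_diff A B f n (pure_tensor A B f ?xs)) \<eta> =
      F (\<Sum>k\<le>Suc n. frag_cmul ((- 1) ^ k) (frag_of (insert_nth k \<one>\<^bsub>B\<^esub> ?xs)))"
    by (simp only: F_def amitsur_pre_def insert_unit_eq len)
  also have "\<dots> = (\<Oplus>\<^bsub>R \<eta>\<^esub>k\<in>{..Suc n}. add_pow (R \<eta>) ((- 1) ^ k :: int) (F (frag_of (insert_nth k \<one>\<^bsub>B\<^esub> ?xs))))"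
    using ins by (intro R.hom_free_sum[OF F]) simp
  also have "\<dots> = (\<Oplus>\<^bsub>R \<eta>\<^esub>k\<in>{..Suc n}. add_pow (R \<eta>) ((- 1) ^ k :: int)
      (r (delete_nth k \<eta>) \<eta> (\<phi> n (pure_tensor A B f ?xs) (delete_nth k \<eta>))))"
  proof (rule R.finsum_cong'[OF refl])
    have term_eq: "F (frag_of (insert_nth k \<one>\<^bsub>B\<^esub> ?xs)) =
        r (delete_nth k \<eta>) \<eta> (\<phi> n (pure_tensor A B f ?xs) (delete_nth k \<eta>))" if "k \<le> Suc n" for k
      unfolding F_of by (rule \<phi>_insert_unit[OF \<zeta> ys \<eta> that])
    then show "(\<lambda>k. add_pow (R \<eta>) ((- 1) ^ k :: int)
        (r (delete_nth k \<eta>) \<eta> (\<phi> n (pure_tensor A B f ?xs) (delete_nth k \<eta>)))) \<in> {..Suc n} \<rightarrow> carrier (R \<eta>)"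
      using F_closed by (auto simp flip: term_eq)
    show "add_pow (R \<eta>) ((- 1) ^ k :: int) (F (frag_of (insert_nth k \<one>\<^bsub>B\<^esub> ?xs))) = add_pow (R \<eta>) ((- 1) ^ k :: int)
        (r (delete_nth k \<eta>) \<eta> (\<phi> n (pure_tensor A B f ?xs) (delete_nth k \<eta>)))" if "k \<in> {..Suc n}" for k
      using term_eq that by simp
  qed
  also have "\<dots> = functor_diff I R r (Suc n) (\<phi> n (pure_tensor A B f ?xs)) \<eta>"
    by (rule functor_diff_eq[OF \<eta> \<phi>xs, symmetric])
  finally show "\<phi> (Suc n) (amitsur_diff A B f n (pure_tensor A B f ?xs)) \<eta> =
      functor_diff I R r (Suc n) (\<phi> n (pure_tensor A B f ?xs)) \<eta>" .
qed

text \<open>A tensor in degree \<open>n\<close> has \<open>n + 1\<close> entries and so lands in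
  level \<open>n + 1\<close>: the target is the functor complex shifted by one, its differential
  keeping its sign. \<open>hom_eq_on_summand_tensors\<close> extends the identity from homogeneous
  tensors to all of \<open>C^n\<close>.\<close>

lemma cochain_map_\<phi>:
  "cochain_map (amitsur_group A B f) (amitsur_diff A B f)
    (\<lambda>n. functor_group I R (Suc n)) (\<lambda>n. functor_diff I R r (Suc n)) \<phi>"
  unfolding cochain_map_def
proof (intro conjI allI ballI)
  show "cochain_complex (amitsur_group A B f) (amitsur_diff A B f)"
    by (rule cochain_complex_amitsur)
  show "cochain_complex (\<lambda>n. functor_group I R (Suc n)) (\<lambda>n. functor_diff I R r (Suc n))"
    using cochain_complex_functor_group by (simp add: cochain_complex_def)
  fix n
  show "\<phi> n \<in> hom (amitsur_group A B f n) (functor_group I R (Suc n))"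
    by (rule hom_\<phi>)
  fix T assume T: "T \<in> carrier (amitsur_group A B f n)"
  have "(\<phi> (Suc n) \<circ> amitsur_diff A B f n) T = (functor_diff I R r (Suc n) \<circ> \<phi> n) T"
  proof (rule hom_eq_on_summand_tensors[OF ring_extension_axioms finite_index ring_Q comm_group_functor_group])
    show "\<phi> (Suc n) \<circ> amitsur_diff A B f n \<in> hom (tens (Suc n)) (functor_group I R (Suc (Suc n)))"
      using hom_compose[OF amitsur_diff_hom hom_\<phi>] by (simp add: amitsur_group_def)
    show "functor_diff I R r (Suc n) \<circ> \<phi> n \<in> hom (tens (Suc n)) (functor_group I R (Suc (Suc n)))"
      using hom_compose[OF hom_\<phi> functor_diff_hom] by (simp add: amitsur_group_def)
    show "T \<in> carrier (tens (Suc n))"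
      using T by (simp add: amitsur_group_def)
  qed (simp_all add: \<phi>_diff_pure less_Suc_eq_le)
  then show "\<phi> (Suc n) (amitsur_diff A B f n T) = functor_diff I R r (Suc n) (\<phi> n T)"
    by simp
qed

end

section \<open>The ring extension given by a covering\<close>

lemma covering_map_hom:
  assumes "\<And>i. i \<in> I \<Longrightarrow> ideal (J i) A"
  shows "covering_map A I J \<in> ring_hom A (covering_ring A I J)"
proof -
  have hom: "(+>\<^bsub>A\<^esub>) (J i) \<in> ring_hom A (A Quot J i)" if "i \<in> I" for i
    using assms[OF that] by (rule ideal.rcos_ring_hom)
  show ?thesis
    unfolding covering_map_def covering_ring_def
    using ring_hom_closed[OF hom] ring_hom_mult[OF hom] ring_hom_add[OF hom] ring_hom_one[OF hom]
    by (intro ring_hom_memI) (auto simp: direct_sum_ring_ops carrier_direct_sum_ring intro!: restrict_ext)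
qed

theorem proposition2p4:
  fixes K :: "('k, 'c) ring_scheme"
    and A :: "('k, 'a, 'b) module_scheme"
    and I :: "'i set" and J :: "'i \<Rightarrow> 'a set"
    and R :: "'i list \<Rightarrow> ('r, 'm) ring_scheme"
    and r :: "'i list \<Rightarrow> 'i list \<Rightarrow> 'r \<Rightarrow> 'r"
    and \<Phi> :: "'i \<Rightarrow> 'a set \<Rightarrow> 'r"
    and \<phi> :: "nat \<Rightarrow> (('i \<Rightarrow> 'a set) list \<Rightarrow>\<^sub>0 int) set \<Rightarrow> 'i list \<Rightarrow> 'r"
  defines "B \<equiv> covering_ring A I J"
    and "\<pi> \<equiv> covering_map A I J"
  assumes "unital_algebra K A"
    and "covering A I J"
    and "ordered_subset_functor I R r"
    and "\<And>i. i \<in> I \<Longrightarrow> \<Phi> i \<in> ring_hom (A Quot J i) (R [i])"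
    and "\<And>n. \<phi> n \<in> hom (amitsur_group A B \<pi> n) (functor_group I R (Suc n))"
    and "\<And>n \<zeta> ys. \<lbrakk>length \<zeta> = Suc n; set \<zeta> \<subseteq> I; length ys = Suc n;
           \<forall>k \<le> n. ys ! k \<in> carrier (A Quot J (\<zeta> ! k))\<rbrakk> \<Longrightarrow>
         \<phi> n (pure_tensor A B \<pi> (map2 (summand I (\<lambda>i. A Quot J i)) \<zeta> ys)) =
           (if \<zeta> \<in> ordered_subsets I
            then summand (level I (Suc n)) R \<zeta> (phi_value R r \<Phi> \<zeta> ys)
            else \<one>\<^bsub>functor_group I R (Suc n)\<^esub>)"
  shows "cochain_complex (functor_group I R) (functor_diff I R r) \<and>
         cochain_map (amitsur_group A B \<pi>) (amitsur_diff A B \<pi>)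
           (\<lambda>n. functor_group I R (Suc n)) (\<lambda>n. functor_diff I R r (Suc n)) \<phi>"
proof -
  have "ring A"
    using assms(3) by (simp add: unital_algebra_def)
  have "finite I" and ideal: "ideal (J i) A" if "i \<in> I" for i
    using assms(4) that by (auto simp: covering_def)
  have quot: "ring (A Quot J i)" if "i \<in> I" for i
    using ideal[OF that] by (rule ideal.quotient_is_ring)
  have B: "B = direct_sum_ring I (\<lambda>i. A Quot J i)"
    by (simp add: B_def covering_ring_def)
  \<comment> \<open>With \<open>B\<close> written as a direct sum, the prescription for
    \<open>\<phi>\<close> in the hypotheses is the one of \<open>comparison\<close> for
    \<open>Q i = A/I_i\<close>.\<close>
  interpret comparison I R r A "\<lambda>i. A Quot J i" \<pi> \<Phi> \<phi>
  proof (intro comparison.intro functor_complex.intro ring_extension.intro comparison_axioms.intro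
      ring_extension_axioms.intro)
    show "finite I"
      using assms(4) by (simp add: covering_def)
    show "ring (direct_sum_ring I (\<lambda>i. A Quot J i))"
      using quot by (rule ring_direct_sum_ring)
    show "\<pi> \<in> ring_hom A (direct_sum_ring I (\<lambda>i. A Quot J i))"
      using covering_map_hom[of I J A] ideal by (simp add: \<pi>_def covering_ring_def)
  qed (use \<open>ring A\<close> assms(5-8) quot in \<open>simp_all add: B\<close>)
  show ?thesis
    using cochain_complex_functor_group cochain_map_\<phi> by (simp add: B)
qed

end
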